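(* Let $X$ be a diffeological space and let $x\in X$. Then there is an isomorphism of real vector spaces $$\operatorname{Ran}_{i_*^{loc}} T^{\mathrm{Eucl}_*^{loc}}(X,x)\;\cong\;\hat T^R_x(X),$$ where the left-hand side is the value at $(X,x)$ of the (pointwise) right Kan extension of the tangent functor $T^{\mathrm{Eucl}_*^{loc}}\colon \mathrm{Eucl}_*^{loc}\to \mathrm{Vect}$ along the inclusion functor $i_*^{loc}\colon \mathrm{Eucl}_*^{loc}\to\mathrm{Dflg}_*^{loc}$, and the right-hand side is the right tangent space of $X$ at $x$.
   Context: A Euclidean open set is an open subset of $\mathbb{R}^n$ for some $n\ge 0$. A parametrization of a set $X$ is a map $U\to X$ with $U$ a Euclidean open set. A diffeology on $X$ is a set of parametrizations, called plots, such that: every constant parametrization is a plot; a parametrization $U\to X$ that restricts to a plot on each member of some open cover of $U$ is a plot; if $p\colon U\to X$ is a plot and $f\colon V\to U$ is a $C^\infty$ map from a Euclidean open set, then $p\circ f$ is a plot. A diffeological space is a set with a diffeology. A map $f\colon X\to Y$ of diffeological spaces is smooth if $f\circ p$ is a plot of $Y$ for every plot $p$ of $X$. Euclidean open sets carry the diffeology of all $C^\infty$ parametrizations. The $D$-topology on $X$ is the largest topology making all plots continuous; its open sets are called $D$-open. A subset $Y\subset X$ carries the subdiffeology: the parametrizations of $Y$ that are plots of $X$. $\mathrm{Dflg}_*^{loc}$ is the category whose objects are pointed diffeological spaces $(X,x)$ and whose morphisms $(X,x)\to(Y,y)$ are germs at $x$ of smooth maps $f\colon B\to Y$ with $B$ a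 $D$-open neighbourhood of $x$ and $f(x)=y$ (two such maps are identified if they agree on some $D$-open neighbourhood of $x$). $\mathrm{Eucl}_*^{loc}$ is its full subcategory on pointed Euclidean open sets. The functor $T^{\mathrm{Eucl}_*^{loc}}\colon\mathrm{Eucl}_*^{loc}\to\mathrm{Vect}$ (real vector spaces) sends $(U,u)$ to $T_uU$ and the germ of $f\colon(U,u)\to(V,v)$ to $df_u$. The comma category $(X,x)\downarrow i_*^{loc}$ has as objects the germs $G=[g,B_g]$ at $x$ of smooth maps $g\colon B_g\to V_G$, with $B_g$ a $D$-open neighbourhood of $x$ and $V_G$ a Euclidean open set (pointed at $G(x):=g(x)$); a morphism $G\to H$ is a germ $s\colon (V_G,G(x))\to (V_H,H(x))$ of smooth maps with $s\circ G=H$. Concretely, $\operatorname{Ran}_{i_*^{loc}} T^{\mathrm{Eucl}_*^{loc}}(X,x)$ is the vector space of families $\{v_G\}_G\in\prod_G T_{G(x)}V_G$ indexed by the objects $G$ of $(X,x)\downarrow i_*^{loc}$ with $ds_{G(x)}(v_G)=v_H$ for every morphism $s\colon G\to H$. $G(X,x)$ denotes the $\mathbb{R}$-algebra of germs $[g,B]$ at $x$ of smooth functions $g\colon B\to\mathbb{R}$, $B$ a $D$-open neighbourhood of $x$. The right tangent space $\hat T^R_x(X)$ is the vector space of linear maps $D\colon G(X,x)\to\mathbb{R}$ satisfying the Leibniz rule $D([g,B]\,[h,B'])=g(x)D([h,B'])+h(x)D([g,B])$. *)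

theory Defs
  imports "HOL-Analysis.Analysis" "HOL-Library.Function_Algebras"
begin

section \<open>Smooth maps between Euclidean open sets\<close>

text \<open>
  The dimension of a Euclidean open set is an arbitrary natural number, so \<open>\<real>\<^sup>n\<close> is modelled by
  the library space \<^const>\<open>Euclidean_space\<close>, whose points are the sequences vanishing from
  index \<open>n\<close> on. A Euclidean open set is a pair \<open>(n, U)\<close> with \<open>U\<close> open in \<open>Euclidean_space n\<close>.
\<close>

primrec C_k :: "nat \<Rightarrow> nat \<Rightarrow> (nat \<Rightarrow> real) set \<Rightarrow> ((nat \<Rightarrow> real) \<Rightarrow> real) \<Rightarrow> bool" where
  "C_k 0 n U f \<longleftrightarrow> continuous_map (subtopology (Euclidean_space n) U) euclideanreal f"
| "C_k (Suc k) n U f \<longleftrightarrow>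
     continuous_map (subtopology (Euclidean_space n) U) euclideanreal f \<and>
     (\<forall>i<n. \<exists>g. (\<forall>u\<in>U. ((\<lambda>t. f (u(i := t))) has_real_derivative g u) (at (u i))) \<and> C_k k n U g)"

definition C_inf :: "nat \<Rightarrow> (nat \<Rightarrow> real) set \<Rightarrow> ((nat \<Rightarrow> real) \<Rightarrow> real) \<Rightarrow> bool" where
  "C_inf n U f \<longleftrightarrow> (\<forall>k. C_k k n U f)"

definition C_inf_map ::
  "nat \<Rightarrow> (nat \<Rightarrow> real) set \<Rightarrow> nat \<Rightarrow> (nat \<Rightarrow> real) set \<Rightarrow> ((nat \<Rightarrow> real) \<Rightarrow> nat \<Rightarrow> real) \<Rightarrow> bool" where
  "C_inf_map n U m V f \<longleftrightarrow> f \<in> U \<rightarrow>\<^sub>E V \<and> (\<forall>j<m. C_inf n U (\<lambda>u. f u j))"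

text \<open>
  The differential of a smooth map as the linear map \<open>\<real>\<^sup>n \<rightarrow> \<real>\<^sup>m\<close> given by the Jacobian matrix
  at \<open>u\<close>; \<^const>\<open>Euclidean_space\<close> has no norm, so the library's Frechet derivative is unavailable.
\<close>

definition differential ::
  "nat \<Rightarrow> nat \<Rightarrow> ((nat \<Rightarrow> real) \<Rightarrow> nat \<Rightarrow> real) \<Rightarrow> (nat \<Rightarrow> real) \<Rightarrow> (nat \<Rightarrow> real) \<Rightarrow> nat \<Rightarrow> real" where
  "differential n m f u w =
     (\<lambda>j. if j < m then (\<Sum>i<n. deriv (\<lambda>t. f (u(i := t)) j) (u i) * w i) else 0)"


section \<open>Diffeological spaces\<close>

text \<open>
  A parametrization \<open>U \<rightarrow> X\<close> with \<open>U\<close> open in \<open>\<real>\<^sup>n\<close> is a triple \<open>(n, U, p)\<close>. Functions on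
  subsets are extensional throughout, so that equality of functions means equality on the domain.
\<close>

type_synonym 'a parametrization = "nat \<times> (nat \<Rightarrow> real) set \<times> ((nat \<Rightarrow> real) \<Rightarrow> 'a)"

record 'a dspace =
  points :: "'a set"
  plots :: "'a parametrization set"

locale diffeological_space =
  fixes X :: "'a dspace"
  assumes plots_parametrizations:
      "(n, U, p) \<in> plots X \<Longrightarrow> openin (Euclidean_space n) U \<and> p \<in> U \<rightarrow>\<^sub>E points X"
    and plots_const:
      "\<lbrakk>openin (Euclidean_space n) U; c \<in> points X\<rbrakk> \<Longrightarrow> (n, U, \<lambda>u\<in>U. c) \<in> plots X"
    and plots_local:
      "\<lbrakk>p \<in> U \<rightarrow>\<^sub>E points X; \<And>W. W \<in> \<W> \<Longrightarrow> openin (Euclidean_space n) W; \<Union>\<W> = U;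
        \<And>W. W \<in> \<W> \<Longrightarrow> (n, W, restrict p W) \<in> plots X\<rbrakk> \<Longrightarrow> (n, U, p) \<in> plots X"
    and plots_compose:
      "\<lbrakk>(n, U, p) \<in> plots X; openin (Euclidean_space m) V; C_inf_map m V n U f\<rbrakk>
        \<Longrightarrow> (m, V, compose V p f) \<in> plots X"

definition smooth_map :: "'a dspace \<Rightarrow> 'b dspace \<Rightarrow> ('a \<Rightarrow> 'b) \<Rightarrow> bool" where
  "smooth_map X Y f \<longleftrightarrow>
     f \<in> points X \<rightarrow>\<^sub>E points Y \<and> (\<forall>(n, U, p) \<in> plots X. (n, U, compose U f p) \<in> plots Y)"

definition subdiffeology :: "'a dspace \<Rightarrow> 'a set \<Rightarrow> 'a dspace" where
  "subdiffeology X Y = \<lparr>points = Y, plots = {(n, U, p) \<in> plots X. p \<in> U \<rightarrow>\<^sub>E Y}\<rparr>"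

definition euclidean_dspace :: "nat \<Rightarrow> (nat \<Rightarrow> real) set \<Rightarrow> (nat \<Rightarrow> real) dspace" where
  "euclidean_dspace m V =
     \<lparr>points = V, plots = {(n, U, p). openin (Euclidean_space n) U \<and> C_inf_map n U m V p}\<rparr>"

definition real_dspace :: "real dspace" where
  "real_dspace =
     \<lparr>points = UNIV,
      plots = {(n, U, p). openin (Euclidean_space n) U \<and> p \<in> extensional U \<and> C_inf n U p}\<rparr>"

definition D_topology :: "'a dspace \<Rightarrow> 'a topology" where
  "D_topology X = topology (\<lambda>W. W \<subseteq> points X \<and>
     (\<forall>(n, U, p) \<in> plots X. openin (Euclidean_space n) {u \<in> U. p u \<in> W}))"

lemma openin_D_topology:
  "openin (D_topology X) W \<longleftrightarrow> W \<subseteq> points X \<and>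
     (\<forall>(n, U, p) \<in> plots X. openin (Euclidean_space n) {u \<in> U. p u \<in> W})"
proof -
  let ?L = "\<lambda>W. W \<subseteq> points X \<and>
     (\<forall>(n, U, p) \<in> plots X. openin (Euclidean_space n) {u \<in> U. p u \<in> W})"
  have "istopology ?L"
    unfolding istopology_def
  proof (intro conjI allI impI)
    fix S T assume "?L S" "?L T"
    moreover have "{u \<in> U. p u \<in> S \<inter> T} = {u \<in> U. p u \<in> S} \<inter> {u \<in> U. p u \<in> T}"
      for U :: "(nat \<Rightarrow> real) set" and p by auto
    ultimately show "S \<inter> T \<subseteq> points X"
      and "\<forall>(n, U, p) \<in> plots X. openin (Euclidean_space n) {u \<in> U. p u \<in> S \<inter> T}"
      by (auto intro!: openin_Int)
  next
    fix K assume K: "\<forall>S\<in>K. ?L S"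
    have "{u \<in> U. p u \<in> \<Union>K} = (\<Union>S\<in>K. {u \<in> U. p u \<in> S})"
      for U :: "(nat \<Rightarrow> real) set" and p by auto
    then show "\<Union>K \<subseteq> points X"
      and "\<forall>(n, U, p) \<in> plots X. openin (Euclidean_space n) {u \<in> U. p u \<in> \<Union>K}"
      using K by (auto intro!: openin_Union)
  qed
  then show ?thesis
    by (simp add: D_topology_def topology_inverse')
qed

lemma (in diffeological_space) topspace_D_topology: "topspace (D_topology X) = points X"
proof
  show "topspace (D_topology X) \<subseteq> points X"
    by (metis openin_D_topology openin_topspace)
  have "{u \<in> U. p u \<in> points X} = U" if "(n, U, p) \<in> plots X" for n U p
    using plots_parametrizations[OF that] by auto
  then have "openin (D_topology X) (points X)"
    using plots_parametrizations by (auto simp: openin_D_topology)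
  then show "points X \<subseteq> topspace (D_topology X)"
    by (rule openin_subset)
qed

text \<open>The D-topology is the largest topology making all plots continuous.\<close>

lemma (in diffeological_space) continuous_map_plot:
  assumes "(n, U, p) \<in> plots X"
  shows "continuous_map (subtopology (Euclidean_space n) U) (D_topology X) p"
proof -
  have U: "openin (Euclidean_space n) U" and p: "p \<in> U \<rightarrow>\<^sub>E points X"
    using plots_parametrizations[OF assms] by auto
  have top: "topspace (subtopology (Euclidean_space n) U) = U"
    using openin_subset[OF U] by auto
  show ?thesis
    unfolding continuous_map_def top topspace_D_topology
    using p U assms by (auto simp: openin_D_topology openin_open_subtopology)
qed

lemma (in diffeological_space) D_topology_largest:
  assumes "topspace T = points X"
    and cont: "\<And>n U p. (n, U, p) \<in> plots X \<Longrightarrow>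
           continuous_map (subtopology (Euclidean_space n) U) T p"
    and "openin T W"
  shows "openin (D_topology X) W"
proof -
  have "openin (Euclidean_space n) {u \<in> U. p u \<in> W}" if "(n, U, p) \<in> plots X" for n U p
  proof -
    have U: "openin (Euclidean_space n) U"
      using plots_parametrizations[OF that] by auto
    have "topspace (subtopology (Euclidean_space n) U) = U"
      using openin_subset[OF U] by auto
    then have "openin (subtopology (Euclidean_space n) U) {u \<in> U. p u \<in> W}"
      using openin_continuous_map_preimage[OF cont[OF that] \<open>openin T W\<close>] by simp
    then show ?thesis
      using U by (simp add: openin_open_subtopology)
  qed
  then show ?thesis
    using assms openin_subset by (fastforce simp: openin_D_topology)
qed


section \<open>Germs of smooth maps\<close>

definition local_maps :: "'a dspace \<Rightarrow> 'a \<Rightarrow> 'b dspace \<Rightarrow> ('a set \<times> ('a \<Rightarrow> 'b)) set" where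
  "local_maps X x Y =
     {(B, f). openin (D_topology X) B \<and> x \<in> B \<and> smooth_map (subdiffeology X B) Y f}"

definition germ_rel ::
  "'a dspace \<Rightarrow> 'a \<Rightarrow> 'b dspace \<Rightarrow> (('a set \<times> ('a \<Rightarrow> 'b)) \<times> ('a set \<times> ('a \<Rightarrow> 'b))) set" where
  "germ_rel X x Y =
     {((B, f), (B', f')). (B, f) \<in> local_maps X x Y \<and> (B', f') \<in> local_maps X x Y \<and>
        (\<exists>W. openin (D_topology X) W \<and> x \<in> W \<and> W \<subseteq> B \<inter> B' \<and> (\<forall>b\<in>W. f b = f' b))}"

lemma equiv_germ_rel: "equiv (local_maps X x Y) (germ_rel X x Y)"
proof (rule equivI)
  show "germ_rel X x Y \<subseteq> local_maps X x Y \<times> local_maps X x Y"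
    by (auto simp: germ_rel_def)
  show "refl_on (local_maps X x Y) (germ_rel X x Y)"
    by (auto simp: refl_on_def germ_rel_def local_maps_def)
  show "sym (germ_rel X x Y)"
    unfolding sym_def germ_rel_def by (auto, (metis (lifting))?)
  show "trans (germ_rel X x Y)"
  proof (rule transI)
    fix r s t assume "(r, s) \<in> germ_rel X x Y" "(s, t) \<in> germ_rel X x Y"
    then obtain B f B' f' B'' f'' W W' where
      "r = (B, f)" "s = (B', f')" "t = (B'', f'')"
      "(B, f) \<in> local_maps X x Y" "(B'', f'') \<in> local_maps X x Y"
      "openin (D_topology X) W" "x \<in> W" "W \<subseteq> B \<inter> B'" "\<forall>b\<in>W. f b = f' b"
      "openin (D_topology X) W'" "x \<in> W'" "W' \<subseteq> B' \<inter> B''" "\<forall>b\<in>W'. f' b = f'' b"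
      unfolding germ_rel_def by auto
    then show "(r, t) \<in> germ_rel X x Y"
      unfolding germ_rel_def by (auto intro!: exI[of _ "W \<inter> W'"])
  qed
qed

type_synonym ('a, 'b) germ = "('a set \<times> ('a \<Rightarrow> 'b)) set"

definition germs :: "'a dspace \<Rightarrow> 'a \<Rightarrow> 'b dspace \<Rightarrow> ('a, 'b) germ set" where
  "germs X x Y = local_maps X x Y // germ_rel X x Y"

definition germ_of :: "'a dspace \<Rightarrow> 'a \<Rightarrow> 'b dspace \<Rightarrow> 'a set \<Rightarrow> ('a \<Rightarrow> 'b) \<Rightarrow> ('a, 'b) germ" where
  "germ_of X x Y B f = germ_rel X x Y `` {(B, f)}"

definition germ_value :: "'a \<Rightarrow> ('a, 'b) germ \<Rightarrow> 'b" where
  "germ_value x G = snd (SOME r. r \<in> G) x"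

text \<open>The hom-set from \<open>(X, x)\<close> to \<open>(Y, y)\<close> in \<open>Dflg\<^sub>*\<^sup>l\<^sup>o\<^sup>c\<close> is \<open>pointed_germs X x Y y\<close>.\<close>

definition pointed_germs :: "'a dspace \<Rightarrow> 'a \<Rightarrow> 'b dspace \<Rightarrow> 'b \<Rightarrow> ('a, 'b) germ set" where
  "pointed_germs X x Y y = {G \<in> germs X x Y. germ_value x G = y}"

definition germ_compose ::
  "'a dspace \<Rightarrow> 'a \<Rightarrow> 'c dspace \<Rightarrow> ('b, 'c) germ \<Rightarrow> ('a, 'b) germ \<Rightarrow> ('a, 'c) germ" where
  "germ_compose X x Z s G =
     (\<Union>(C, h)\<in>s. \<Union>(B, g)\<in>G. germ_of X x Z {b \<in> B. g b \<in> C} (\<lambda>b\<in>{b \<in> B. g b \<in> C}. h (g b)))"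


section \<open>The right Kan extension of the tangent functor\<close>

text \<open>
  An object \<open>(m, V, v)\<close> of \<open>Eucl\<^sub>*\<^sup>l\<^sup>o\<^sup>c\<close> is an open subset \<open>V\<close> of \<open>\<real>\<^sup>m\<close> with base point \<open>v\<close>.
\<close>

type_synonym eucl_object = "nat \<times> (nat \<Rightarrow> real) set \<times> (nat \<Rightarrow> real)"

definition eucl_objects :: "eucl_object set" where
  "eucl_objects = {(m, V, v). openin (Euclidean_space m) V \<and> v \<in> V}"

fun eucl_morphisms ::
  "eucl_object \<Rightarrow> eucl_object \<Rightarrow> (nat \<Rightarrow> real, nat \<Rightarrow> real) germ set" where
  "eucl_morphisms (n, U, u) (m, V, v) =
     pointed_germs (euclidean_dspace n U) u (euclidean_dspace m V) v"

text \<open>The tangent functor, with \<open>T\<^sub>uU\<close> identified with \<open>\<real>\<^sup>n\<close> for \<open>U\<close> open in \<open>\<real>\<^sup>n\<close>.\<close>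

fun tangent_space :: "eucl_object \<Rightarrow> (nat \<Rightarrow> real) set" where
  "tangent_space (n, U, u) = topspace (Euclidean_space n)"

fun tangent_map ::
  "eucl_object \<Rightarrow> eucl_object \<Rightarrow> (nat \<Rightarrow> real, nat \<Rightarrow> real) germ \<Rightarrow> (nat \<Rightarrow> real) \<Rightarrow> nat \<Rightarrow> real" where
  "tangent_map (n, U, u) (m, V, v) s = differential n m (snd (SOME r. r \<in> s)) u"

text \<open>
  The comma category \<open>(X, x) \<down> i\<^sub>*\<^sup>l\<^sup>o\<^sup>c\<close>: an object is an object \<open>(m, V, v)\<close> of \<open>Eucl\<^sub>*\<^sup>l\<^sup>o\<^sup>c\<close>
  together with a morphism \<open>G: (X, x) \<rightarrow> (V, v)\<close>. The base point \<open>v\<close> is determined by \<open>G\<close>.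
\<close>

type_synonym 'a comma_object = "eucl_object \<times> ('a, nat \<Rightarrow> real) germ"

definition comma_objects :: "'a dspace \<Rightarrow> 'a \<Rightarrow> 'a comma_object set" where
  "comma_objects X x =
     {((m, V, v), G). (m, V, v) \<in> eucl_objects \<and> G \<in> pointed_germs X x (euclidean_dspace m V) v}"

fun comma_morphisms ::
  "'a dspace \<Rightarrow> 'a \<Rightarrow> 'a comma_object \<Rightarrow> 'a comma_object \<Rightarrow> (nat \<Rightarrow> real, nat \<Rightarrow> real) germ set" where
  "comma_morphisms X x (E, G) ((m, V, v), H) =
     {s \<in> eucl_morphisms E (m, V, v). germ_compose X x (euclidean_dspace m V) s G = H}"

text \<open>
  The limit of the tangent functor over the comma category, as a set of compatible families.
  Families are taken to be zero off the index set, so that the vector space operations are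
  the pointwise ones.
\<close>

definition Ran_tangent :: "'a dspace \<Rightarrow> 'a \<Rightarrow> ('a comma_object \<Rightarrow> nat \<Rightarrow> real) set" where
  "Ran_tangent X x =
     {w. (\<forall>K \<in> comma_objects X x. w K \<in> tangent_space (fst K)) \<and>
         (\<forall>K. K \<notin> comma_objects X x \<longrightarrow> w K = 0) \<and>
         (\<forall>K \<in> comma_objects X x. \<forall>L \<in> comma_objects X x. \<forall>s \<in> comma_morphisms X x K L.
            tangent_map (fst K) (fst L) s (w K) = w L)}"


section \<open>The right tangent space\<close>

abbreviation function_germs :: "'a dspace \<Rightarrow> 'a \<Rightarrow> ('a, real) germ set" where
  "function_germs X x \<equiv> germs X x real_dspace"

definition germ_add ::
  "'a dspace \<Rightarrow> 'a \<Rightarrow> ('a, real) germ \<Rightarrow> ('a, real) germ \<Rightarrow> ('a, real) germ" where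
  "germ_add X x G H =
     (\<Union>(B, g)\<in>G. \<Union>(B', h)\<in>H. germ_of X x real_dspace (B \<inter> B') (\<lambda>b\<in>B \<inter> B'. g b + h b))"

definition germ_mult ::
  "'a dspace \<Rightarrow> 'a \<Rightarrow> ('a, real) germ \<Rightarrow> ('a, real) germ \<Rightarrow> ('a, real) germ" where
  "germ_mult X x G H =
     (\<Union>(B, g)\<in>G. \<Union>(B', h)\<in>H. germ_of X x real_dspace (B \<inter> B') (\<lambda>b\<in>B \<inter> B'. g b * h b))"

definition germ_scale :: "'a dspace \<Rightarrow> 'a \<Rightarrow> real \<Rightarrow> ('a, real) germ \<Rightarrow> ('a, real) germ" where
  "germ_scale X x c G = (\<Union>(B, g)\<in>G. germ_of X x real_dspace B (\<lambda>b\<in>B. c * g b))"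

definition right_tangent_space :: "'a dspace \<Rightarrow> 'a \<Rightarrow> (('a, real) germ \<Rightarrow> real) set" where
  "right_tangent_space X x =
     {D. (\<forall>G. G \<notin> function_germs X x \<longrightarrow> D G = 0) \<and>
         (\<forall>G \<in> function_germs X x. \<forall>H \<in> function_germs X x.
            D (germ_add X x G H) = D G + D H) \<and>
         (\<forall>c. \<forall>G \<in> function_germs X x. D (germ_scale X x c G) = c * D G) \<and>
         (\<forall>G \<in> function_germs X x. \<forall>H \<in> function_germs X x.
            D (germ_mult X x G H) = germ_value x G * D H + germ_value x H * D G)}"


section \<open>Isomorphism of spaces of functions\<close>

instantiation "fun" :: (type, scaleR) scaleR
begin

definition "c *\<^sub>R f = (\<lambda>a. c *\<^sub>R f a)"

instance ..

end

instance "fun" :: (type, real_vector) real_vector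
  by standard (simp_all add: scaleR_fun_def fun_eq_iff scaleR_add_right scaleR_add_left)

definition linear_iso ::
  "'v::real_vector set \<Rightarrow> 'w::real_vector set \<Rightarrow> ('v \<Rightarrow> 'w) \<Rightarrow> bool" where
  "linear_iso S T \<phi> \<longleftrightarrow> subspace S \<and> subspace T \<and> bij_betw \<phi> S T \<and>
     (\<forall>u\<in>S. \<forall>v\<in>S. \<phi> (u + v) = \<phi> u + \<phi> v) \<and> (\<forall>c. \<forall>u\<in>S. \<phi> (c *\<^sub>R u) = c *\<^sub>R \<phi> u)"

end

(* A family v compatible with all morphisms of the comma category is determined by its entries at
   the germs of real-valued functions, because coordinate projections are morphisms; compatibility
   with addition, multiplication and scaling, viewed as smooth maps R^2 -> R, says precisely that
   these entries form a derivation. Conversely, a derivation D yields the family whose component at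
   a germ G into R^m has coordinates D(pr_j o G). Its compatibility is the chain rule
   D(s o G) = sum_j (d_j s)(G(x)) D(pr_j o G), which follows from Hadamard's lemma: near G(x),
   s = s(G(x)) + sum_j (u_j - G_j(x)) q_j with q_j smooth and q_j(G(x)) = (d_j s)(G(x)). *)

theory Submission
  imports Defs
begin

text \<open>Points of R^n are sequences vanishing from index \<open>n\<close> on, and smoothness
  means iterated partial derivatives. Two analytic facts have to be earned from partials alone: the
  chain rule, from their continuity, and the smoothness of Hadamard's coefficients, which are
  averages of partials over segments and are differentiated under the integral sign. Cubes serve
  both purposes, being star-shaped about their centre and stable under bounded changes of one
  coordinate. Since a derivation acts on germs, an expansion valid only on a small cube about
  \<open>G(x)\<close> is enough, because the preimage of the cube is D-open. That entries at single
  functions can be combined at all rests on pairing: two functions on a common neighbourhood form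
  one germ into R^2, and the component there is fixed by its two projections. Several definitions
  choose a representative of a germ; each is shown to give the same value on every representative
  before it is used.\<close>

section \<open>Calculus on Euclidean open sets\<close>

text \<open>Bridge from the abstract topology of \<open>Euclidean_space n\<close> to the type class
  topology on sequences, so that the rules for \<open>continuous_on\<close> apply.\<close>

lemma continuous_map_Euclidean_subspace:
  assumes "U \<subseteq> topspace (Euclidean_space n)"
  shows "continuous_map (subtopology (Euclidean_space n) U) euclideanreal f \<longleftrightarrow> continuous_on U f"
proof -
  have "subtopology (Euclidean_space n) U = top_of_set U"
    using assms unfolding Euclidean_space_def euclidean_product_topology
    by (simp add: subtopology_subtopology Int_absorb1)
  then show ?thesis by simp
qed

section \<open>Coordinate cubes as basic neighbourhoods\<close>

text \<open>The sup-norm ball of R^n. Unlike a general open set it contains the segments from its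
  centre and the coordinate paths used for mean value estimates.\<close>

definition cube :: "nat \<Rightarrow> (nat \<Rightarrow> real) \<Rightarrow> real \<Rightarrow> (nat \<Rightarrow> real) set" where
  "cube n v e = {u \<in> topspace (Euclidean_space n). \<forall>i<n. \<bar>u i - v i\<bar> < e}"

lemma openin_cube: "openin (Euclidean_space n) (cube n v e)"
proof -
  have "open (\<Inter>i\<in>{..<n}. {u :: nat \<Rightarrow> real. \<bar>u i - v i\<bar> < e})"
    by (intro open_INT finite_lessThan ballI open_Collect_less continuous_intros)
       (auto intro: continuous_on_product_coordinates)
  moreover have "cube n v e = (\<Inter>i\<in>{..<n}. {u. \<bar>u i - v i\<bar> < e}) \<inter> topspace (Euclidean_space n)"
    by (auto simp: cube_def)
  ultimately show ?thesis
    unfolding Euclidean_space_def euclidean_product_topology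
    by (auto simp: openin_subtopology)
qed

lemma center_in_cube: "v \<in> topspace (Euclidean_space n) \<Longrightarrow> 0 < e \<Longrightarrow> v \<in> cube n v e"
  by (auto simp: cube_def)

text \<open>Coordinates from \<open>n\<close> on vanish throughout R^n, so the least of the first
  \<open>n\<close> radii of a product neighbourhood suffices.\<close>

lemma openin_contains_cube:
  assumes "openin (Euclidean_space n) U" "v \<in> U"
  obtains e where "0 < e" "cube n v e \<subseteq> U"
proof -
  obtain T where T: "openin (powertop_real UNIV) T" "U = T \<inter> topspace (Euclidean_space n)"
    using assms(1) unfolding Euclidean_space_def by (auto simp: openin_subtopology)
  with assms(2) have "v \<in> T" by auto
  from product_topology_open_contains_basis[OF T(1) this]
  obtain S where S: "v \<in> (\<Pi>\<^sub>E i\<in>UNIV. S i)" "\<And>i. open (S i)"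
      "finite {i. S i \<noteq> UNIV}" "(\<Pi>\<^sub>E i\<in>UNIV. S i) \<subseteq> T"
    by auto
  have "\<exists>d>0. ball (v i) d \<subseteq> S i" for i
    using S(1,2) open_contains_ball by (metis PiE_iff UNIV_I)
  then obtain d where d: "\<And>i. d i > 0" "\<And>i. ball (v i) (d i) \<subseteq> S i"
    by metis
  \<comment> \<open>The element 1 keeps the set nonempty when \<open>n = 0\<close>.\<close>
  define e where "e = Min (insert 1 (d ` {..<n}))"
  have e: "0 < e" "\<And>i. i < n \<Longrightarrow> e \<le> d i"
    unfolding e_def using d(1) by auto
  have "w \<in> U" if w: "w \<in> cube n v e" for w
  proof -
    have "w i \<in> S i" for i
    proof (cases "i < n")
      case True
      then have "w i \<in> ball (v i) (d i)"
        using w e(2)[of i] by (auto simp: cube_def dist_real_def abs_minus_commute intro: less_le_trans)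
      then show ?thesis using d(2) by blast
    next
      case False
      then have "w i = v i"
        using w assms openin_subset[OF assms(1)] by (auto simp: cube_def topspace_Euclidean_space)
      then show ?thesis using S(1) by auto
    qed
    then show ?thesis
      using S(4) w T(2) by (auto simp: cube_def)
  qed
  with e(1) that show ?thesis by blast
qed

lemma cube_upd:
  "u \<in> cube n v e \<Longrightarrow> i < n \<Longrightarrow> \<bar>t - v i\<bar> < e \<Longrightarrow> u(i := t) \<in> cube n v e"
  by (auto simp: cube_def topspace_Euclidean_space)

lemma cube_convex:
  assumes "u \<in> cube n v e" "v \<in> topspace (Euclidean_space n)" "0 \<le> t" "t \<le> 1"
  shows "(\<lambda>j. v j + t * (u j - v j)) \<in> cube n v e"
proof -
  have "\<bar>t * (u j - v j)\<bar> < e" if "j < n" for j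
  proof -
    have "\<bar>t * (u j - v j)\<bar> \<le> 1 * \<bar>u j - v j\<bar>"
      using assms(3,4) by (simp add: abs_mult mult_left_le_one_le)
    then show ?thesis using assms(1) that by (auto simp: cube_def)
  qed
  with assms show ?thesis by (auto simp: cube_def topspace_Euclidean_space)
qed

text \<open>Makes a partial derivative at a point of \<open>U\<close> depend only on values in
  \<open>U\<close>, although \<open>f\<close> is total and \<open>u(i := t)\<close> may leave
  \<open>U\<close>.\<close>

lemma eventually_upd_in_open:
  assumes "openin (Euclidean_space n) U" "u \<in> U" "i < n"
  shows "\<forall>\<^sub>F t in nhds (u i). u(i := t) \<in> U"
proof -
  obtain e where e: "0 < e" "cube n u e \<subseteq> U"
    using openin_contains_cube[OF assms(1,2)] .
  have "u \<in> cube n u e"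
    using center_in_cube openin_subset[OF assms(1)] assms(2) e(1) by blast
  then have "u(i := t) \<in> U" if "t \<in> ball (u i) e" for t
    using that cube_upd[of u n u e i t] e assms(3)
    by (auto simp: dist_real_def abs_minus_commute)
  then show ?thesis
    using e(1) by (auto intro!: eventually_nhds_in_open[THEN eventually_mono, of "ball (u i) e"])
qed

section \<open>Partial derivatives and closure properties of smooth functions\<close>

text \<open>Matches the Jacobian entries in \<open>differential\<close> literally, so that the two
  agree by unfolding.\<close>

definition partial :: "nat \<Rightarrow> ((nat \<Rightarrow> real) \<Rightarrow> real) \<Rightarrow> (nat \<Rightarrow> real) \<Rightarrow> real" where
  "partial i f u = deriv (\<lambda>t. f (u(i := t))) (u i)"

lemma partial_cong:
  assumes "openin (Euclidean_space n) U" "u \<in> U" "i < n" "\<And>w. w \<in> U \<Longrightarrow> f w = g w"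
  shows "partial i f u = partial i g u"
  unfolding partial_def
  by (intro deriv_cong_ev refl)
     (use eventually_upd_in_open[OF assms(1-3)] assms(4) in \<open>auto elim!: eventually_mono\<close>)

lemma has_derivative_upd_cong:
  assumes "openin (Euclidean_space n) U" "u \<in> U" "i < n" "\<And>w. w \<in> U \<Longrightarrow> f w = g w"
  shows "((\<lambda>t. f (u(i := t))) has_real_derivative D) (at (u i)) \<longleftrightarrow>
         ((\<lambda>t. g (u(i := t))) has_real_derivative D) (at (u i))"
  by (intro DERIV_cong_ev refl)
     (use eventually_upd_in_open[OF assms(1-3)] assms(4) in \<open>auto elim!: eventually_mono\<close>)

lemma C_k_cong:
  assumes U: "openin (Euclidean_space n) U"
  shows "(\<And>u. u \<in> U \<Longrightarrow> f u = g u) \<Longrightarrow> C_k k n U f \<longleftrightarrow> C_k k n U g"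
proof (induction k arbitrary: f g)
  case 0
  then show ?case
    using continuous_map_Euclidean_subspace[OF openin_subset[OF U]] by (simp cong: continuous_on_cong)
next
  case (Suc k)
  have c: "continuous_on U f \<longleftrightarrow> continuous_on U g"
    using Suc.prems by (simp cong: continuous_on_cong)
  have d: "((\<lambda>t. f (u(i := t))) has_real_derivative D) (at (u i)) \<longleftrightarrow>
         ((\<lambda>t. g (u(i := t))) has_real_derivative D) (at (u i))" if "u \<in> U" "i < n" for u i D
    by (rule has_derivative_upd_cong[OF U]) (use that Suc.prems in auto)
  show ?case
    using c d by (simp add: continuous_map_Euclidean_subspace[OF openin_subset[OF U]])
qed

lemma C_inf_cong:
  "openin (Euclidean_space n) U \<Longrightarrow> (\<And>u. u \<in> U \<Longrightarrow> f u = g u) \<Longrightarrow> C_inf n U f \<longleftrightarrow> C_inf n U g"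
  unfolding C_inf_def using C_k_cong by blast

lemma C_k_0_iff:
  "openin (Euclidean_space n) U \<Longrightarrow> C_k 0 n U f \<longleftrightarrow> continuous_on U f"
  using continuous_map_Euclidean_subspace[OF openin_subset] by simp

lemma C_k_SucI:
  assumes "openin (Euclidean_space n) U" "continuous_on U f"
    and "\<And>i u. i < n \<Longrightarrow> u \<in> U \<Longrightarrow> ((\<lambda>t. f (u(i := t))) has_real_derivative g i u) (at (u i))"
    and "\<And>i. i < n \<Longrightarrow> C_k k n U (g i)"
  shows "C_k (Suc k) n U f"
  using assms continuous_map_Euclidean_subspace[OF openin_subset[OF assms(1)]] by auto

text \<open>Derivatives are unique, so the existentially quantified derivative in \<open>C_k\<close>
  equals \<open>partial i f\<close> on \<open>U\<close>. Later inductions on \<open>k\<close> work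
  with this canonical choice.\<close>

lemma C_k_SucD:
  assumes U: "openin (Euclidean_space n) U" and f: "C_k (Suc k) n U f"
  shows "continuous_on U f"
    and "\<And>i u. i < n \<Longrightarrow> u \<in> U \<Longrightarrow> ((\<lambda>t. f (u(i := t))) has_real_derivative partial i f u) (at (u i))"
    and "\<And>i. i < n \<Longrightarrow> C_k k n U (partial i f)"
proof -
  show "continuous_on U f"
    using f continuous_map_Euclidean_subspace[OF openin_subset[OF U]] by auto
  fix i assume i: "i < n"
  then obtain g where g: "\<And>u. u \<in> U \<Longrightarrow> ((\<lambda>t. f (u(i := t))) has_real_derivative g u) (at (u i))"
      "C_k k n U g"
    using f unfolding C_k.simps by meson
  have eq: "partial i f u = g u" if "u \<in> U" for u
    unfolding partial_def using DERIV_imp_deriv[OF g(1)[OF that]] .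
  then show "((\<lambda>t. f (u(i := t))) has_real_derivative partial i f u) (at (u i))" if "u \<in> U" for u
    using g(1) that by simp
  show "C_k k n U (partial i f)"
    using C_k_cong[OF U, of "partial i f" g] eq g(2) by blast
qed

lemma C_k_continuous:
  "openin (Euclidean_space n) U \<Longrightarrow> C_k k n U f \<Longrightarrow> continuous_on U f"
  by (cases k) (auto simp: C_k_0_iff dest: C_k_SucD(1) simp del: C_k.simps)

lemma C_k_Suc_imp: 
  assumes U: "openin (Euclidean_space n) U"
  shows "C_k (Suc k) n U f \<Longrightarrow> C_k k n U f"
proof (induction k arbitrary: f)
  case 0
  then show ?case using C_k_SucD(1)[OF U 0] C_k_0_iff[OF U] by blast
next
  case (Suc k)
  show ?case
    by (rule C_k_SucI[OF U C_k_SucD(1,2)[OF U Suc.prems]])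
       (use Suc.IH C_k_SucD(3)[OF U Suc.prems] in auto)
qed

lemma C_inf_continuous:
  "openin (Euclidean_space n) U \<Longrightarrow> C_inf n U f \<Longrightarrow> continuous_on U f"
  unfolding C_inf_def using C_k_continuous by blast

lemma C_inf_partial:
  "openin (Euclidean_space n) U \<Longrightarrow> C_inf n U f \<Longrightarrow> i < n \<Longrightarrow> C_inf n U (partial i f)"
  unfolding C_inf_def using C_k_SucD(3) by blast

lemma C_k_mono:
  assumes U: "openin (Euclidean_space n) U" and W: "openin (Euclidean_space n) W" "W \<subseteq> U"
  shows "C_k k n U f \<Longrightarrow> C_k k n W f"
proof (induction k arbitrary: f)
  case 0
  then show ?case using C_k_0_iff U W continuous_on_subset by metis
next
  case (Suc k)
  note S = C_k_SucD[OF U Suc.prems]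
  show ?case
    by (rule C_k_SucI[OF W(1) continuous_on_subset[OF S(1) W(2)], of "\<lambda>i. partial i f"])
       (use S W Suc.IH in auto)
qed

lemma C_inf_mono:
  "openin (Euclidean_space n) U \<Longrightarrow> openin (Euclidean_space n) W \<Longrightarrow> W \<subseteq> U \<Longrightarrow>
    C_inf n U f \<Longrightarrow> C_inf n W f"
  unfolding C_inf_def using C_k_mono by blast

lemma C_k_const:
  assumes U: "openin (Euclidean_space n) U"
  shows "C_k k n U (\<lambda>u. c)"
proof (induction k arbitrary: c)
  case 0
  then show ?case by (simp add: C_k_0_iff[OF U] del: C_k.simps)
next
  case (Suc k)
  show ?case by (rule C_k_SucI[OF U _ _ Suc, of _ "\<lambda>i. 0"]) auto
qed

lemma C_k_coordinate:
  assumes U: "openin (Euclidean_space n) U"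
  shows "C_k k n U (\<lambda>u. u j)"
proof (cases k)
  case 0
  have "continuous_on U (\<lambda>u. u j)"
    by (rule continuous_on_subset[OF continuous_on_product_coordinates]) auto
  then show ?thesis by (simp add: 0 C_k_0_iff[OF U] del: C_k.simps)
next
  case (Suc l)
  have c: "continuous_on U (\<lambda>u. u j)"
    by (rule continuous_on_subset[OF continuous_on_product_coordinates]) auto
  have "C_k (Suc l) n U (\<lambda>u. u j)"
    by (rule C_k_SucI[OF U c, of "\<lambda>i u. if i = j then 1 else 0"])
       (auto intro: C_k_const[OF U])
  then show ?thesis by (simp add: Suc)
qed

lemma C_k_add:
  assumes U: "openin (Euclidean_space n) U"
  shows "C_k k n U f \<Longrightarrow> C_k k n U g \<Longrightarrow> C_k k n U (\<lambda>u. f u + g u)"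
proof (induction k arbitrary: f g)
  case 0
  then show ?case by (auto simp: C_k_0_iff[OF U] simp del: C_k.simps intro: continuous_intros)
next
  case (Suc k)
  note F = C_k_SucD[OF U Suc.prems(1)] and G = C_k_SucD[OF U Suc.prems(2)]
  show ?case
    by (rule C_k_SucI[OF U _ _ Suc.IH[OF F(3) G(3)]])
       (use F(1,2) G(1,2) in \<open>auto intro!: continuous_intros derivative_eq_intros\<close>)
qed

lemma C_k_mult:
  assumes U: "openin (Euclidean_space n) U"
  shows "C_k k n U f \<Longrightarrow> C_k k n U g \<Longrightarrow> C_k k n U (\<lambda>u. f u * g u)"
proof (induction k arbitrary: f g)
  case 0
  then show ?case by (auto simp: C_k_0_iff[OF U] simp del: C_k.simps intro: continuous_intros)
next
  case (Suc k)
  note F = C_k_SucD[OF U Suc.prems(1)] and G = C_k_SucD[OF U Suc.prems(2)]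
  \<comment> \<open>The product rule leaves one factor undifferentiated, so both factors are needed
    at order \<open>k\<close> as well.\<close>
  have f: "C_k k n U f" and g: "C_k k n U g"
    using Suc.prems C_k_Suc_imp[OF U] by blast+
  have "((\<lambda>t. f (u(i := t)) * g (u(i := t))) has_real_derivative
      partial i f u * g u + f u * partial i g u) (at (u i))" if "i < n" "u \<in> U" for i u
    by (rule DERIV_cong[OF DERIV_mult[OF F(2)[OF that] G(2)[OF that]]]) (simp add: mult.commute)
  then show ?case
    by (rule C_k_SucI[OF U continuous_on_mult[OF F(1) G(1)] _
          C_k_add[OF U Suc.IH[OF F(3) g] Suc.IH[OF f G(3)]]])
qed

lemma C_k_sum:
  assumes U: "openin (Euclidean_space n) U" and "finite I" "\<And>i. i \<in> I \<Longrightarrow> C_k k n U (f i)"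
  shows "C_k k n U (\<lambda>u. \<Sum>i\<in>I. f i u)"
  using assms(2,3) by (induction I rule: finite_induct) (auto intro: C_k_const[OF U] C_k_add[OF U])

lemma C_inf_const: "openin (Euclidean_space n) U \<Longrightarrow> C_inf n U (\<lambda>u. c)"
  and C_inf_coordinate: "openin (Euclidean_space n) U \<Longrightarrow> C_inf n U (\<lambda>u. u j)"
  and C_inf_add: "openin (Euclidean_space n) U \<Longrightarrow> C_inf n U f \<Longrightarrow> C_inf n U g \<Longrightarrow>
    C_inf n U (\<lambda>u. f u + g u)"
  and C_inf_mult: "openin (Euclidean_space n) U \<Longrightarrow> C_inf n U f \<Longrightarrow> C_inf n U g \<Longrightarrow>
    C_inf n U (\<lambda>u. f u * g u)"
  unfolding C_inf_def by (blast intro: C_k_const C_k_coordinate C_k_add C_k_mult)+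

section \<open>The chain rule\<close>

text \<open>
  Passing from \<open>a\<close> to \<open>w\<close> one coordinate at a time, the mean value theorem yields a
  Caratheodory-style factorization of \<open>f w - f a\<close>.
\<close>

lemma difference_factorization:
  assumes U: "openin (Euclidean_space n) U" and a: "a \<in> U" and f: "C_k (Suc k) n U f"
  obtains q where "\<forall>w\<in>U. f w - f a = (\<Sum>j<n. q j w * (w j - a j))"
    and "\<forall>\<epsilon>>0. \<exists>d>0. \<forall>w\<in>cube n a d. \<forall>j<n. \<bar>q j w - partial j f a\<bar> \<le> \<epsilon>"
proof -
  note F = C_k_SucD[OF U f]
  have at: "a \<in> topspace (Euclidean_space n)"
    using a openin_subset[OF U] by blast
  \<comment> \<open>Corners of the coordinate path from \<open>a\<close> to \<open>w\<close>. They
    may leave \<open>U\<close>, which does not disturb the telescoping sum, but they stay in every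
    cube about \<open>a\<close> that contains \<open>w\<close>, where the estimate is made.\<close>
  define hyb where "hyb w j = (\<lambda>i. if i < j then w i else a i)" for w :: "nat \<Rightarrow> real" and j :: nat
  \<comment> \<open>Where the difference quotient degenerates, the coefficient is set to its
    intended limit; its error there is 0.\<close>
  define q where "q j w = (if w j = a j then partial j f a
     else (f (hyb w (Suc j)) - f (hyb w j)) / (w j - a j))" for j w
  have hyb_upd: "hyb w (Suc j) = (hyb w j)(j := w j)" "hyb w j = (hyb w j)(j := a j)" for w j
    by (auto simp: hyb_def fun_eq_iff less_Suc_eq)
  have step: "f (hyb w (Suc j)) - f (hyb w j) = q j w * (w j - a j)" for w j
  proof (cases "w j = a j")
    case True
    then have "hyb w (Suc j) = hyb w j" using hyb_upd by metis
    then show ?thesis using True by simp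
  qed (simp add: q_def)
  have "f w - f a = (\<Sum>j<n. q j w * (w j - a j))" if "w \<in> U" for w
  proof -
    have "hyb w n = w" "hyb w 0 = a"
      using subsetD[OF openin_subset[OF U] that] at by (auto simp: hyb_def topspace_Euclidean_space fun_eq_iff)
    then show ?thesis
      using sum_lessThan_telescope[of "\<lambda>j. f (hyb w j)" n] step by simp
  qed
  moreover have "\<exists>d>0. \<forall>w\<in>cube n a d. \<forall>j<n. \<bar>q j w - partial j f a\<bar> \<le> \<epsilon>" if \<epsilon>: "0 < \<epsilon>" for \<epsilon>
  proof -
    have "\<exists>d>0. cube n a d \<subseteq> U \<and> (\<forall>w\<in>cube n a d. \<bar>partial j f w - partial j f a\<bar> < \<epsilon>)" if "j < n" for j
    proof -
      have "continuous_map (subtopology (Euclidean_space n) U) euclideanreal (partial j f)"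
        using C_k_continuous[OF U F(3)[OF that]]
        by (simp add: continuous_map_Euclidean_subspace[OF openin_subset[OF U]])
      then have "openin (subtopology (Euclidean_space n) U)
          {w \<in> topspace (subtopology (Euclidean_space n) U). partial j f w \<in> ball (partial j f a) \<epsilon>}"
        by (rule openin_continuous_map_preimage) auto
      then have "openin (Euclidean_space n) {w \<in> U. partial j f w \<in> ball (partial j f a) \<epsilon>}"
        using openin_subset[OF U] U by (simp add: openin_open_subtopology Int_absorb1)
      moreover have "a \<in> {w \<in> U. partial j f w \<in> ball (partial j f a) \<epsilon>}"
        using a \<epsilon> by auto
      ultimately obtain d where "0 < d" "cube n a d \<subseteq> {w \<in> U. partial j f w \<in> ball (partial j f a) \<epsilon>}"
        using openin_contains_cube by blast
      then show ?thesis by (auto simp: dist_real_def abs_minus_commute)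
    qed
    then obtain d where d: "\<And>j. j < n \<Longrightarrow> 0 < d j" "\<And>j. j < n \<Longrightarrow> cube n a (d j) \<subseteq> U"
      "\<And>j w. j < n \<Longrightarrow> w \<in> cube n a (d j) \<Longrightarrow> \<bar>partial j f w - partial j f a\<bar> < \<epsilon>"
      by metis
    define e where "e = Min (insert 1 (d ` {..<n}))"
    have e: "0 < e" "\<And>i. i < n \<Longrightarrow> e \<le> d i"
      unfolding e_def using d(1) by auto
    have "\<bar>q j w - partial j f a\<bar> \<le> \<epsilon>" if w: "w \<in> cube n a e" and j: "j < n" for w j
    proof (cases "w j = a j")
      case True
      then show ?thesis using \<epsilon> by (simp add: q_def)
    next
      case False
      have sub: "cube n a e \<subseteq> cube n a (d j)"
        using e(2)[OF j] by (fastforce simp: cube_def)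
      have "hyb w j \<in> cube n a e"
        using w at e(1) by (auto simp: cube_def hyb_def topspace_Euclidean_space)
      then have C: "(hyb w j)(j := t) \<in> cube n a (d j)" if "t \<in> ball (a j) e" for t
        using cube_upd[OF _ j, of "hyb w j" a e t] sub that by (auto simp: dist_real_def abs_minus_commute)
      \<comment> \<open>Subtracting the linear term makes the derivative at most \<epsilon> in
        absolute value, so the mean value inequality directly compares the difference quotient with
        \<open>partial j f a\<close>.\<close>
      have der: "((\<lambda>t. f ((hyb w j)(j := t)) - partial j f a * t) has_field_derivative
          partial j f ((hyb w j)(j := t)) - partial j f a) (at t within ball (a j) e)"
        if "t \<in> ball (a j) e" for t
      proof -
        have "((\<lambda>t. f ((hyb w j)(j := t))) has_real_derivative partial j f ((hyb w j)(j := t))) (at t)"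
          using F(2)[OF j, of "(hyb w j)(j := t)"] subsetD[OF d(2)[OF j] C[OF that]] by simp
        from DERIV_diff[OF this DERIV_cmult_Id[of "partial j f a" t]]
        show ?thesis by (rule DERIV_subset) simp
      qed
      have "w j \<in> ball (a j) e" "a j \<in> ball (a j) e"
        using w j e(1) by (auto simp: cube_def dist_real_def abs_minus_commute)
      from field_differentiable_bound[OF convex_ball der _ this, where B = \<epsilon>] d(3)[OF j C]
      have "\<bar>(f ((hyb w j)(j := w j)) - partial j f a * w j) -
             (f ((hyb w j)(j := a j)) - partial j f a * a j)\<bar> \<le> \<epsilon> * \<bar>w j - a j\<bar>"
        by (simp add: less_imp_le)
      moreover have "(f ((hyb w j)(j := w j)) - partial j f a * w j) -
             (f ((hyb w j)(j := a j)) - partial j f a * a j) = (q j w - partial j f a) * (w j - a j)"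
        using step[of w j] hyb_upd[of w j] by (simp add: algebra_simps)
      ultimately show ?thesis
        using False by (simp add: abs_mult)
    qed
    with e(1) show ?thesis by blast
  qed
  ultimately have "\<forall>w\<in>U. f w - f a = (\<Sum>j<n. q j w * (w j - a j))"
    "\<forall>\<epsilon>>0. \<exists>d>0. \<forall>w\<in>cube n a d. \<forall>j<n. \<bar>q j w - partial j f a\<bar> \<le> \<epsilon>"
    by auto
  then show ?thesis by (rule that)
qed

text \<open>Divide the factorization of \<open>f (\<gamma> t) - f (\<gamma> t0)\<close> by
  \<open>t - t0\<close>: the coefficients tend to the partials and the remaining factors to
  \<gamma>'. The derivative is taken within \<open>S\<close> to cover both coordinate lines and the
  endpoints of the segments in \<open>Hadamard\<close>.\<close>

lemma curve_chain_rule: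
  assumes U: "openin (Euclidean_space n) U" and \<gamma>0: "\<gamma> t0 \<in> U" and f: "C_k (Suc k) n U f"
    and U\<gamma>: "\<forall>\<^sub>F t in at t0 within S. \<gamma> t \<in> U"
    and \<gamma>: "\<And>j. j < n \<Longrightarrow> ((\<lambda>t. \<gamma> t j) has_real_derivative \<gamma>' j) (at t0 within S)"
  shows "((\<lambda>t. f (\<gamma> t)) has_real_derivative (\<Sum>j<n. partial j f (\<gamma> t0) * \<gamma>' j)) (at t0 within S)"
proof -
  obtain q where q: "\<forall>w\<in>U. f w - f (\<gamma> t0) = (\<Sum>j<n. q j w * (w j - \<gamma> t0 j))"
    "\<forall>\<epsilon>>0. \<exists>d>0. \<forall>w\<in>cube n (\<gamma> t0) d. \<forall>j<n. \<bar>q j w - partial j f (\<gamma> t0)\<bar> \<le> \<epsilon>"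
    using difference_factorization[OF U \<gamma>0 f] .
  have cube: "\<forall>\<^sub>F t in at t0 within S. \<gamma> t \<in> cube n (\<gamma> t0) d" if "0 < d" for d
  proof -
    have "\<forall>\<^sub>F t in at t0 within S. \<bar>\<gamma> t j - \<gamma> t0 j\<bar> < d" if "j < n" for j
    proof -
      have "((\<lambda>t. \<gamma> t j) \<longlongrightarrow> \<gamma> t0 j) (at t0 within S)"
        using DERIV_continuous[OF \<gamma>[OF that]] by (simp add: continuous_within)
      from tendstoD[OF this \<open>0 < d\<close>] show ?thesis by (simp add: dist_real_def)
    qed
    then have "\<forall>\<^sub>F t in at t0 within S. \<forall>j\<in>{..<n}. \<bar>\<gamma> t j - \<gamma> t0 j\<bar> < d"
      by (auto simp: eventually_ball_finite_distrib)
    with U\<gamma> show ?thesis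
      by eventually_elim (use openin_subset[OF U] in \<open>auto simp: cube_def\<close>)
  qed
  have lim: "((\<lambda>t. q j (\<gamma> t)) \<longlongrightarrow> partial j f (\<gamma> t0)) (at t0 within S)" if "j < n" for j
  proof (rule tendstoI)
    fix \<epsilon> :: real assume "0 < \<epsilon>"
    then obtain d where "0 < d" and d: "\<forall>w\<in>cube n (\<gamma> t0) d. \<forall>j<n. \<bar>q j w - partial j f (\<gamma> t0)\<bar> \<le> \<epsilon> / 2"
      using q(2)[rule_format, of "\<epsilon> / 2"] by auto
    show "\<forall>\<^sub>F t in at t0 within S. dist (q j (\<gamma> t)) (partial j f (\<gamma> t0)) < \<epsilon>"
      using cube[OF \<open>0 < d\<close>] by eventually_elim (use d that \<open>0 < \<epsilon>\<close> in \<open>fastforce simp: dist_real_def\<close>)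
  qed
  have "((\<lambda>t. \<Sum>j<n. q j (\<gamma> t) * ((\<gamma> t j - \<gamma> t0 j) / (t - t0))) \<longlongrightarrow>
      (\<Sum>j<n. partial j f (\<gamma> t0) * \<gamma>' j)) (at t0 within S)"
    by (intro tendsto_sum tendsto_mult lim) (use \<gamma> in \<open>auto simp: has_field_derivative_iff\<close>)
  moreover have "\<forall>\<^sub>F t in at t0 within S. (\<Sum>j<n. q j (\<gamma> t) * ((\<gamma> t j - \<gamma> t0 j) / (t - t0)))
      = (f (\<gamma> t) - f (\<gamma> t0)) / (t - t0)"
    using U\<gamma> by eventually_elim (simp add: q(1) sum_divide_distrib)
  ultimately show ?thesis
    unfolding has_field_derivative_iff by (rule Lim_transform_eventually)
qed

text \<open>The partials of the composite are sums of products of \<open>partial j f\<close>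
  composed with \<open>q\<close> and partials of \<open>q\<close>. The induction keeps
  \<open>q\<close> fixed and lets \<open>f\<close> vary, so that it applies to
  \<open>partial j f\<close>.\<close>

lemma C_k_compose:
  assumes U: "openin (Euclidean_space n) U" and V: "openin (Euclidean_space m) V" and qV: "q \<in> U \<rightarrow> V"
  shows "(\<And>j. j < m \<Longrightarrow> C_k k n U (\<lambda>u. q u j)) \<Longrightarrow> C_k k m V f \<Longrightarrow> C_k k n U (\<lambda>u. f (q u))"
proof (induction k arbitrary: f)
  have cont: "continuous_on U (\<lambda>u. f (q u))"
    if "\<And>j. j < m \<Longrightarrow> continuous_on U (\<lambda>u. q u j)" "continuous_on V f" for f :: "_ \<Rightarrow> real"
  proof -
    \<comment> \<open>Continuity into the sequence space concerns all coordinates; those from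
      \<open>m\<close> on are constantly 0 because \<open>V\<close> lies in R^m.\<close>
    have "continuous_on U (\<lambda>u. q u j)" for j
    proof (cases "j < m")
      case False
      then have "q u j = 0" if "u \<in> U" for u
        using qV that openin_subset[OF V] by (auto simp: topspace_Euclidean_space)
      then show ?thesis by (simp cong: continuous_on_cong)
    qed (use that in auto)
    then have "continuous_on U q"
      by (rule continuous_on_coordinatewise_then_product)
    then show ?thesis
      by (rule continuous_on_compose2[OF that(2)]) (use qV in auto)
  qed
  {
    case 0
    then show ?case
      unfolding C_k_0_iff[OF U] C_k_0_iff[OF V] by (rule cont)
  next
    case (Suc k)
    note F = C_k_SucD[OF V Suc.prems(2)] and Q = C_k_SucD[OF U Suc.prems(1)]
    show ?case
    proof (rule C_k_SucI[OF U, where g = "\<lambda>i u. \<Sum>j<m. partial j f (q u) * partial i (\<lambda>u. q u j) u"])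
      show "continuous_on U (\<lambda>u. f (q u))" by (rule cont[OF Q(1) F(1)])
    next
      fix i assume i: "i < n"
      show "C_k k n U (\<lambda>u. \<Sum>j<m. partial j f (q u) * partial i (\<lambda>u. q u j) u)"
      proof (rule C_k_sum[OF U finite_lessThan], rule C_k_mult[OF U])
        fix j assume "j \<in> {..<m}"
        then have j: "j < m" by simp
        show "C_k k n U (\<lambda>u. partial j f (q u))"
          by (rule Suc.IH[OF C_k_Suc_imp[OF U Suc.prems(1)] F(3)[OF j]])
        show "C_k k n U (partial i (\<lambda>u. q u j))"
          by (rule Q(3)[OF j i])
      qed
      fix u assume u: "u \<in> U"
      have ev: "\<forall>\<^sub>F t in at (u i). q (u(i := t)) \<in> V"
        using eventually_upd_in_open[OF U u i] unfolding eventually_at_filter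
        by eventually_elim (use qV in auto)
      have "((\<lambda>t. f (q (u(i := t)))) has_real_derivative
          (\<Sum>j<m. partial j f (q (u(i := u i))) * partial i (\<lambda>u. q u j) u)) (at (u i))"
      proof (rule curve_chain_rule[OF V, where \<gamma> = "\<lambda>t. q (u(i := t))"])
        show "((\<lambda>t. q (u(i := t)) j) has_real_derivative partial i (\<lambda>u. q u j) u) (at (u i))"
          if "j < m" for j
          by (rule Q(2)[OF that i u])
        show "q (u(i := u i)) \<in> V" using qV u by auto
      qed (rule Suc.prems(2), rule ev)
      then show "((\<lambda>t. f (q (u(i := t)))) has_real_derivative
          (\<Sum>j<m. partial j f (q u) * partial i (\<lambda>u. q u j) u)) (at (u i))"
        by simp
    qed
  }
qed

lemma C_inf_compose:
  assumes "openin (Euclidean_space n) U" "openin (Euclidean_space m) V" "q \<in> U \<rightarrow> V"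
    and "\<And>j. j < m \<Longrightarrow> C_inf n U (\<lambda>u. q u j)" "C_inf m V f"
  shows "C_inf n U (\<lambda>u. f (q u))"
  using assms(4,5) C_k_compose[OF assms(1-3)] unfolding C_inf_def by blast

section \<open>Hadamard's lemma\<close>

text \<open>The weight \<open>c\<close> makes the statement stable under differentiation in \<open>u\<close>.\<close>

lemma C_k_ray_integral:
  assumes v: "v \<in> topspace (Euclidean_space n)"
  shows "C_k k n (cube n v e) f \<Longrightarrow> continuous_on {0..1} c \<Longrightarrow>
    C_k k n (cube n v e) (\<lambda>u. integral {0..1} (\<lambda>t. c t * f (\<lambda>j. v j + t * (u j - v j))))"
proof (induction k arbitrary: f c)
  have U: "openin (Euclidean_space n) (cube n v e)" by (rule openin_cube)
  have cont2: "continuous_on (cube n v e \<times> cbox 0 1) (\<lambda>(u, t). c t * f (\<lambda>j. v j + t * (u j - v j)))"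
    if f: "continuous_on (cube n v e) f" and c: "continuous_on {0..1} c" for f and c :: "real \<Rightarrow> real"
  proof -
    let ?A = "cube n v e \<times> cbox 0 (1::real)"
    have "continuous_on ?A (\<lambda>z. v j + snd z * (fst z j - v j))" for j
      by (intro continuous_intros
          continuous_on_compose2[OF continuous_on_product_coordinates[of j] continuous_on_fst]) auto
    then have "continuous_on ?A (\<lambda>z j. v j + snd z * (fst z j - v j))"
      by (rule continuous_on_coordinatewise_then_product)
    then have "continuous_on ?A (\<lambda>z. f (\<lambda>j. v j + snd z * (fst z j - v j)))"
      by (rule continuous_on_compose2[OF f]) (use cube_convex v in auto)
    moreover have "continuous_on ?A (\<lambda>z. c (snd z))"
      by (rule continuous_on_compose2[OF c]) (auto intro: continuous_intros)
    ultimately show ?thesis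
      by (auto simp: split_beta intro: continuous_intros)
  qed
  have cont: "continuous_on (cube n v e) (\<lambda>u. integral {0..1} (\<lambda>t. c t * f (\<lambda>j. v j + t * (u j - v j))))"
    if "continuous_on (cube n v e) f" "continuous_on {0..1} c" for f and c :: "real \<Rightarrow> real"
    using integral_continuous_on_param[OF cont2[OF that]] by simp
  {
    case 0
    then show ?case
      unfolding C_k_0_iff[OF U] by (rule cont)
  next
    case (Suc k)
    note F = C_k_SucD[OF U Suc.prems(1)]
    have c': "continuous_on {0..1} (\<lambda>t. c t * t)"
      by (intro continuous_intros Suc.prems)
    show ?case
    proof (rule C_k_SucI[OF U, where g = "\<lambda>i u. integral {0..1}
          (\<lambda>t. (c t * t) * partial i f (\<lambda>j. v j + t * (u j - v j)))"])
      fix i assume i: "i < n"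
      show "C_k k n (cube n v e) (\<lambda>u. integral {0..1}
          (\<lambda>t. (c t * t) * partial i f (\<lambda>j. v j + t * (u j - v j))))"
        by (rule Suc.IH[OF F(3)[OF i] c'])
      fix u assume u: "u \<in> cube n v e"
      \<comment> \<open>Moving coordinate \<open>i\<close> within this interval stays in the cube.
        The interval is convex, as differentiation under the integral requires, and open, so the
        derivative within it is the full derivative.\<close>
      let ?I = "ball (v i) e"
      have upd: "u(i := s) \<in> cube n v e" if "s \<in> ?I" for s
        using cube_upd[OF u i] that by (auto simp: dist_real_def abs_minus_commute)
      have ui: "u i \<in> ?I"
        using u i by (auto simp: cube_def dist_real_def abs_minus_commute)
      have "continuous_on ?I (\<lambda>s. (u(i := s)) j)" for j
        by (cases "j = i") simp_all
      then have upd_cont: "continuous_on ?I (\<lambda>s. u(i := s))"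
        by (rule continuous_on_coordinatewise_then_product)
      let ?r = "\<lambda>s t j. v j + t * ((u(i := s)) j - v j)"
      have "((\<lambda>s. integral (cbox 0 1) (\<lambda>t. c t * f (?r s t))) has_field_derivative
          integral (cbox 0 1) (\<lambda>t. (c t * t) * partial i f (?r (u i) t))) (at (u i) within ?I)"
      proof (rule leibniz_rule_field_derivative[OF _ _ _ ui convex_ball])
        fix s and t :: real assume s: "s \<in> ?I" and t: "t \<in> cbox 0 1"
        let ?w = "?r s t"
        have w: "?w \<in> cube n v e"
          using cube_convex[OF upd[OF s] v] t by auto
        \<comment> \<open>Varying \<open>s'\<close> moves only coordinate \<open>i\<close> of the
          point on the ray, at speed \<open>t\<close>; the one-variable chain rule therefore
          produces the extra factor \<open>t\<close>.\<close>
        have line: "?r s' t = ?w(i := v i + t * (s' - v i))" for s'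
          by auto
        have "((\<lambda>y. f (?w(i := y))) has_real_derivative partial i f ?w) (at (v i + t * (s - v i)))"
          using F(2)[OF i w] by (simp only: fun_upd_same)
        moreover have "((\<lambda>s'. v i + t * (s' - v i)) has_real_derivative t) (at s within ?I)"
          by (auto intro!: derivative_eq_intros)
        ultimately have "((\<lambda>s'. f (?w(i := v i + t * (s' - v i)))) has_real_derivative
            partial i f ?w * t) (at s within ?I)"
          by (rule DERIV_chain2)
        then have "((\<lambda>s'. f (?r s' t)) has_real_derivative partial i f ?w * t) (at s within ?I)"
          by (subst line)
        from DERIV_cmult[OF this, of "c t"]
        show "((\<lambda>s'. c t * f (?r s' t)) has_real_derivative c t * t * partial i f ?w) (at s within ?I)"
          by (simp add: mult_ac)
      next
        fix s assume "s \<in> ?I"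
        have "continuous_on (cbox 0 (1::real)) (\<lambda>t. (u(i := s), t))"
          by (intro continuous_on_Pair continuous_on_const continuous_on_id)
        from continuous_on_compose2[OF cont2[OF F(1) Suc.prems(2)] this]
        have "continuous_on (cbox 0 1) (\<lambda>t. c t * f (?r s t))"
          using upd[OF \<open>s \<in> ?I\<close>] by (simp add: image_subset_iff del: fun_upd_apply)
        then show "(\<lambda>t. c t * f (?r s t)) integrable_on cbox 0 1"
          by (rule integrable_continuous)
      next
        have "continuous_on (?I \<times> cbox 0 1) (\<lambda>z. (u(i := fst z), snd z))"
          by (intro continuous_intros continuous_on_compose2[OF upd_cont]) auto
        from continuous_on_compose2[OF cont2[OF C_k_continuous[OF U F(3)[OF i]] c'] this]
        show "continuous_on (?I \<times> cbox 0 1) (\<lambda>(s, t). c t * t * partial i f (?r s t))"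
          using upd
          by (simp add: split_beta image_subset_iff del: fun_upd_apply)
      qed
      then show "((\<lambda>s. integral {0..1} (\<lambda>t. c t * f (?r s t))) has_real_derivative
          integral {0..1} (\<lambda>t. (c t * t) * partial i f (\<lambda>j. v j + t * (u j - v j)))) (at (u i))"
        using ui by (simp add: at_within_open[OF ui])
    qed (rule cont[OF F(1) Suc.prems(2)])
  }
qed

text \<open>Integrate the derivative of \<open>f\<close> along the segment from \<open>v\<close> to
  \<open>u\<close>. The coefficient of \<open>u i - v i\<close> is the mean of
  \<open>partial i f\<close> over that segment, which is smooth in \<open>u\<close> by
  \<open>C_k_ray_integral\<close> and reduces to \<open>partial i f v\<close> at
  \<open>u = v\<close>.\<close>

lemma Hadamard:
  assumes v: "v \<in> topspace (Euclidean_space n)" and e: "0 < e" and f: "C_inf n (cube n v e) f"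
  obtains h where "\<forall>i<n. C_inf n (cube n v e) (h i)"
    and "\<forall>i<n. h i v = partial i f v"
    and "\<forall>u\<in>cube n v e. f u = f v + (\<Sum>i<n. (u i - v i) * h i u)"
proof -
  have U: "openin (Euclidean_space n) (cube n v e)" by (rule openin_cube)
  \<comment> \<open>The factor 1 is the constant weight \<open>c\<close> of
    \<open>C_k_ray_integral\<close>.\<close>
  define h where "h i u = integral {0..1} (\<lambda>t. 1 * partial i f (\<lambda>j. v j + t * (u j - v j)))" for i u
  have "C_inf n (cube n v e) (h i)" if "i < n" for i
    using C_k_ray_integral[OF v _ continuous_on_const, of _ e "partial i f" 1] C_inf_partial[OF U f that]
    unfolding C_inf_def h_def by blast
  moreover have "h i v = partial i f v" for i
    by (simp add: h_def)
  moreover have "f u = f v + (\<Sum>i<n. (u i - v i) * h i u)" if u: "u \<in> cube n v e" for u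
  proof -
    let ?\<gamma> = "\<lambda>t j. v j + t * (u j - v j)"
    have in_cube: "?\<gamma> t \<in> cube n v e" if "t \<in> {0..1}" for t
      using cube_convex[OF u v] that by auto
    have "((\<lambda>t. f (?\<gamma> t)) has_real_derivative (\<Sum>i<n. partial i f (?\<gamma> t) * (u i - v i)))
        (at t within {0..1})" if t: "t \<in> {0..1}" for t
    proof (rule curve_chain_rule[OF U, where \<gamma> = ?\<gamma>])
      show "?\<gamma> t \<in> cube n v e" by (rule in_cube[OF t])
      show "C_k (Suc 0) n (cube n v e) f" using f unfolding C_inf_def by blast
      show "\<forall>\<^sub>F t in at t within {0..1}. ?\<gamma> t \<in> cube n v e"
        using in_cube by (auto simp: eventually_at_filter)
    qed (auto intro!: derivative_eq_intros)
    then have 1: "((\<lambda>t. \<Sum>i<n. partial i f (?\<gamma> t) * (u i - v i)) has_integral (f (?\<gamma> 1) - f (?\<gamma> 0))) {0..1}"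
      by (intro fundamental_theorem_of_calculus) (auto simp: has_real_derivative_iff_has_vector_derivative)
    have "((\<lambda>t. \<Sum>i<n. partial i f (?\<gamma> t) * (u i - v i)) has_integral (\<Sum>i<n. h i u * (u i - v i))) {0..1}"
    proof (intro has_integral_sum finite_lessThan has_integral_mult_left)
      fix i assume "i \<in> {..<n}"
      then have "continuous_on (cube n v e) (partial i f)"
        using C_inf_continuous[OF U C_inf_partial[OF U f]] by auto
      then have "continuous_on {0..1} (\<lambda>t. partial i f (?\<gamma> t))"
        by (rule continuous_on_compose2)
           (use in_cube in \<open>auto intro!: continuous_on_coordinatewise_then_product continuous_intros\<close>)
      then show "((\<lambda>t. partial i f (?\<gamma> t)) has_integral h i u) {0..1}"
        unfolding h_def by (simp add: integrable_continuous_real integrable_integral)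
    qed
    from has_integral_unique[OF 1 this] show ?thesis
      by (simp add: mult.commute)
  qed
  ultimately show ?thesis by (intro that[of h]) auto
qed

section \<open>Germs\<close>

lemma local_mapsD:
  assumes "(B, f) \<in> local_maps X x Y"
  shows "openin (D_topology X) B" "x \<in> B" "f \<in> B \<rightarrow>\<^sub>E points Y" "restrict f B = f"
    and "\<And>n U p. (n, U, p) \<in> plots X \<Longrightarrow> p \<in> U \<rightarrow>\<^sub>E B \<Longrightarrow> (n, U, compose U f p) \<in> plots Y"
proof -
  show "openin (D_topology X) B" "x \<in> B" and f: "f \<in> B \<rightarrow>\<^sub>E points Y"
    using assms by (auto simp: local_maps_def smooth_map_def subdiffeology_def)
  show "restrict f B = f"
    using f by (simp add: PiE_iff extensional_restrict)
  show "\<And>n U p. (n, U, p) \<in> plots X \<Longrightarrow> p \<in> U \<rightarrow>\<^sub>E B \<Longrightarrow> (n, U, compose U f p) \<in> plots Y"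
    using assms by (auto simp: local_maps_def smooth_map_def subdiffeology_def)
qed

lemma mem_germ_of_iff: "r \<in> germ_of X x Y B f \<longleftrightarrow> ((B, f), r) \<in> germ_rel X x Y"
  by (simp add: germ_of_def)

lemma germ_of_self: "(B, f) \<in> local_maps X x Y \<Longrightarrow> (B, f) \<in> germ_of X x Y B f"
  unfolding germ_of_def by (rule equiv_class_self[OF equiv_germ_rel])

lemma germ_of_cong:
  assumes "(B, f) \<in> local_maps X x Y" "(B', f') \<in> local_maps X x Y"
    and "openin (D_topology X) W" "x \<in> W" "W \<subseteq> B \<inter> B'" "\<And>b. b \<in> W \<Longrightarrow> f b = f' b"
  shows "germ_of X x Y B f = germ_of X x Y B' f'"
  unfolding germ_of_def
  by (rule equiv_class_eq[OF equiv_germ_rel]) (use assms in \<open>auto simp: germ_rel_def\<close>)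

lemma germ_of_in_germs: "(B, f) \<in> local_maps X x Y \<Longrightarrow> germ_of X x Y B f \<in> germs X x Y"
  by (auto simp: germs_def germ_of_def intro: quotientI)

lemma germsE:
  assumes "G \<in> germs X x Y"
  obtains B f where "(B, f) \<in> local_maps X x Y" "G = germ_of X x Y B f"
  using assms unfolding germs_def germ_of_def by (auto elim!: quotientE)

text \<open>Definitions that pick a representative with \<open>SOME\<close> are evaluated through
  this: the one picked agrees near \<open>x\<close> with the one given.\<close>

lemma SOME_germ_of:
  assumes "(B, f) \<in> local_maps X x Y"
  obtains B' f' W where "(SOME r. r \<in> germ_of X x Y B f) = (B', f')" "(B', f') \<in> local_maps X x Y"
    "openin (D_topology X) W" "x \<in> W" "W \<subseteq> B \<inter> B'" "\<And>b. b \<in> W \<Longrightarrow> f b = f' b"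
proof -
  obtain B' f' where r: "(SOME r. r \<in> germ_of X x Y B f) = (B', f')"
    by fastforce
  have "(SOME r. r \<in> germ_of X x Y B f) \<in> germ_of X x Y B f"
    by (rule someI) (rule germ_of_self[OF assms])
  then have "((B, f), (B', f')) \<in> germ_rel X x Y"
    unfolding r by (simp add: mem_germ_of_iff)
  then show ?thesis
    using that[OF r] by (auto simp: germ_rel_def)
qed

lemma germ_value_germ_of: "(B, f) \<in> local_maps X x Y \<Longrightarrow> germ_value x (germ_of X x Y B f) = f x"
  unfolding germ_value_def by (erule SOME_germ_of) simp

text \<open>Operations on germs are unions over all representatives. A class is nonempty, so if
  every term is the same set, any one representative computes the union.\<close>

lemma UN_germ_of:
  assumes "(B, f) \<in> local_maps X x Y"
    and "\<And>B' f' W. (B', f') \<in> local_maps X x Y \<Longrightarrow> openin (D_topology X) W \<Longrightarrow> x \<in> W \<Longrightarrow>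
      W \<subseteq> B \<inter> B' \<Longrightarrow> (\<And>b. b \<in> W \<Longrightarrow> f b = f' b) \<Longrightarrow> F B' f' = S"
  shows "(\<Union>(B', f')\<in>germ_of X x Y B f. F B' f') = S"
proof -
  have "F B' f' = S" if "(B', f') \<in> germ_of X x Y B f" for B' f'
    using that assms(2) by (auto simp: mem_germ_of_iff germ_rel_def)
  then show ?thesis
    using germ_of_self[OF assms(1)] by fastforce
qed

section \<open>Smooth functions on D-open sets\<close>

text \<open>Smoothness for total functions, free of the extensionality built into
  \<open>local_maps\<close>; \<open>local_maps_real_iff\<close> and \<open>local_maps_iff\<close>
  translate between the two.\<close>

definition smooth_fun :: "'a dspace \<Rightarrow> 'a set \<Rightarrow> ('a \<Rightarrow> real) \<Rightarrow> bool" where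
  "smooth_fun X B f \<longleftrightarrow> openin (D_topology X) B \<and>
     (\<forall>(n, U, p) \<in> plots X. p \<in> U \<rightarrow> B \<longrightarrow> C_inf n U (\<lambda>u. f (p u)))"

lemma C_inf_map_preimage:
  assumes U: "openin (Euclidean_space n) U" and V: "openin (Euclidean_space m) V"
    and q: "q \<in> U \<rightarrow> topspace (Euclidean_space m)" "\<And>j. j < m \<Longrightarrow> C_inf n U (\<lambda>u. q u j)"
  shows "openin (Euclidean_space n) {u \<in> U. q u \<in> V}"
proof -
  have top: "topspace (subtopology (Euclidean_space n) U) = U"
    using openin_subset[OF U] by auto
  \<comment> \<open>Zeroing the coordinates from \<open>m\<close> on fits the componentwise
    continuity criterion and leaves \<open>q\<close> unchanged on \<open>U\<close>, since its values
    already lie in R^m.\<close>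
  have "continuous_map (subtopology (Euclidean_space n) U) (Euclidean_space m)
      (\<lambda>u i. if i < m then q u i else 0)"
    unfolding continuous_map_componentwise_Euclidean_space
    using C_inf_continuous[OF U q(2)] continuous_map_Euclidean_subspace[OF openin_subset[OF U]] by blast
  from openin_continuous_map_preimage[OF this V]
  have "openin (Euclidean_space n) {u \<in> U. (\<lambda>i. if i < m then q u i else 0) \<in> V}"
    unfolding top openin_open_subtopology[OF U] by (rule conjunct1)
  moreover have "(\<lambda>i. if i < m then q u i else 0) = q u" if "u \<in> U" for u
    using funcset_mem[OF q(1) that] by (auto simp: topspace_Euclidean_space)
  then have "{u \<in> U. (\<lambda>i. if i < m then q u i else 0) \<in> V} = {u \<in> U. q u \<in> V}"
    by auto
  ultimately show ?thesis by simp
qed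

text \<open>Testing against the identity plot of \<open>U\<close> gives one direction; continuity of
  smooth parametrizations gives the other.\<close>

lemma openin_D_topology_euclidean:
  assumes U: "openin (Euclidean_space n) U"
  shows "openin (D_topology (euclidean_dspace n U)) C \<longleftrightarrow> openin (Euclidean_space n) C \<and> C \<subseteq> U"
proof
  assume C: "openin (D_topology (euclidean_dspace n U)) C"
  have "C_inf n U (\<lambda>u. restrict id U u j)" for j
    using C_inf_coordinate[OF U] C_inf_cong[OF U, of "\<lambda>u. restrict id U u j" "\<lambda>u. u j"] by simp
  then have "C_inf_map n U n U (restrict id U)"
    by (auto simp: C_inf_map_def)
  then have "(n, U, restrict id U) \<in> plots (euclidean_dspace n U)"
    using U by (simp add: euclidean_dspace_def)
  with C have "openin (Euclidean_space n) {u \<in> U. restrict id U u \<in> C}"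
    unfolding openin_D_topology by fast
  moreover have "C \<subseteq> U"
    using C by (auto simp: openin_D_topology euclidean_dspace_def)
  moreover from this have "{u \<in> U. restrict id U u \<in> C} = C" by auto
  ultimately show "openin (Euclidean_space n) C \<and> C \<subseteq> U" by simp
next
  assume C: "openin (Euclidean_space n) C \<and> C \<subseteq> U"
  have "openin (Euclidean_space k) {w \<in> W. p w \<in> C}"
    if "openin (Euclidean_space k) W" "C_inf_map k W n U p" for k W p
    using that C openin_subset[OF U] by (intro C_inf_map_preimage) (auto simp: C_inf_map_def)
  then show "openin (D_topology (euclidean_dspace n U)) C"
    using C by (auto simp: openin_D_topology euclidean_dspace_def)
qed

text \<open>The inclusion of \<open>C\<close> is a plot landing in \<open>C\<close>, and testing on
  it recovers ordinary smoothness; conversely, smooth functions are closed under composition with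
  plots.\<close>

lemma local_maps_euclidean_iff:
  assumes U: "openin (Euclidean_space n) U"
  shows "(C, restrict h C) \<in> local_maps (euclidean_dspace n U) u (euclidean_dspace m V) \<longleftrightarrow>
    openin (Euclidean_space n) C \<and> C \<subseteq> U \<and> u \<in> C \<and> h \<in> C \<rightarrow> V \<and> (\<forall>j<m. C_inf n C (\<lambda>u. h u j))"
    (is "?L \<longleftrightarrow> ?R")
proof
  assume L: ?L
  note l = local_mapsD[OF L]
  have C: "openin (Euclidean_space n) C" "C \<subseteq> U"
    using l(1) openin_D_topology_euclidean[OF U] by auto
  have "C_inf n C (\<lambda>u. restrict id C u j)" for j
    using C_inf_coordinate[OF C(1)] C_inf_cong[OF C(1), of "\<lambda>u. restrict id C u j" "\<lambda>u. u j"] by simp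
  then have "C_inf_map n C n U (restrict id C)"
    using C(2) by (auto simp: C_inf_map_def)
  then have "(n, C, compose C (restrict h C) (restrict id C)) \<in> plots (euclidean_dspace m V)"
    using C by (intro l(5)) (auto simp: euclidean_dspace_def)
  then have "C_inf n C (\<lambda>u. compose C (restrict h C) (restrict id C) u j)" if "j < m" for j
    using that by (simp add: euclidean_dspace_def C_inf_map_def)
  then have "C_inf n C (\<lambda>u. h u j)" if "j < m" for j
    using that C_inf_cong[OF C(1), of "\<lambda>u. compose C (restrict h C) (restrict id C) u j" "\<lambda>u. h u j"]
    by (simp add: compose_def)
  with C l(2,3) show ?R
    by (auto simp: euclidean_dspace_def PiE_iff)
next
  assume R: ?R
  have "C_inf_map k W m V (compose W (restrict h C) p)"
    if W: "openin (Euclidean_space k) W" and p: "C_inf_map k W n U p" "p \<in> W \<rightarrow>\<^sub>E C" for k W p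
  proof -
    have "C_inf k W (\<lambda>w. h (p w) j)" if "j < m" for j
      by (rule C_inf_compose[OF W, of n C p "\<lambda>u. h u j"]) (use R p that in \<open>auto simp: C_inf_map_def\<close>)
    moreover have "C_inf k W (\<lambda>w. compose W (restrict h C) p w j) \<longleftrightarrow> C_inf k W (\<lambda>w. h (p w) j)" for j
      by (rule C_inf_cong[OF W]) (use p in \<open>auto simp: compose_def PiE_iff\<close>)
    ultimately show ?thesis
      using R p by (auto simp: C_inf_map_def compose_def PiE_iff)
  qed
  with R openin_D_topology_euclidean[OF U] show ?L
    by (auto simp: local_maps_def smooth_map_def subdiffeology_def euclidean_dspace_def)
qed

context diffeological_space
begin

lemma plots_openin: "(n, U, p) \<in> plots X \<Longrightarrow> openin (Euclidean_space n) U"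
  using plots_parametrizations by blast

lemma plots_extensional:
  assumes "(n, U, p) \<in> plots X" "p \<in> U \<rightarrow> B"
  shows "p \<in> U \<rightarrow>\<^sub>E B"
  using plots_parametrizations[OF assms(1)] assms(2) by (simp add: PiE_iff Pi_iff)

lemma plots_restrict:
  assumes p: "(n, U, p) \<in> plots X" and W: "openin (Euclidean_space n) W" "W \<subseteq> U"
  shows "(n, W, restrict p W) \<in> plots X"
proof -
  have "C_inf n W (\<lambda>u. restrict id W u j)" for j
    using C_inf_coordinate[OF W(1)] C_inf_cong[OF W(1), of "\<lambda>u. restrict id W u j" "\<lambda>u. u j"] by simp
  then have "C_inf_map n W n U (restrict id W)"
    using W(2) by (auto simp: C_inf_map_def)
  then have "(n, W, compose W p (restrict id W)) \<in> plots X"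
    by (rule plots_compose[OF p W(1)])
  moreover have "compose W p (restrict id W) = restrict p W"
    by (auto simp: compose_def)
  ultimately show ?thesis by simp
qed

lemma smooth_funI:
  assumes "openin (D_topology X) B"
    and "\<And>n U p. openin (Euclidean_space n) U \<Longrightarrow> (n, U, p) \<in> plots X \<Longrightarrow> p \<in> U \<rightarrow> B \<Longrightarrow>
      C_inf n U (\<lambda>u. f (p u))"
  shows "smooth_fun X B f"
  using assms plots_openin unfolding smooth_fun_def by blast

lemma smooth_funD:
  assumes "smooth_fun X B f"
  shows "openin (D_topology X) B"
    and "\<And>n U p. (n, U, p) \<in> plots X \<Longrightarrow> p \<in> U \<rightarrow> B \<Longrightarrow> C_inf n U (\<lambda>u. f (p u))"
  using assms unfolding smooth_fun_def by blast+

lemma smooth_fun_mono: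
  assumes "smooth_fun X B f" "openin (D_topology X) B'" "B' \<subseteq> B"
  shows "smooth_fun X B' f"
  by (rule smooth_funI[OF assms(2)]) (use smooth_funD(2)[OF assms(1)] assms(3) in blast)

lemma smooth_fun_const: "openin (D_topology X) B \<Longrightarrow> smooth_fun X B (\<lambda>b. c)"
  by (rule smooth_funI) (auto intro: C_inf_const)

lemma smooth_fun_add: "smooth_fun X B f \<Longrightarrow> smooth_fun X B g \<Longrightarrow> smooth_fun X B (\<lambda>b. f b + g b)"
  by (rule smooth_funI) (auto intro: C_inf_add dest: smooth_funD)

lemma smooth_fun_mult: "smooth_fun X B f \<Longrightarrow> smooth_fun X B g \<Longrightarrow> smooth_fun X B (\<lambda>b. f b * g b)"
  by (rule smooth_funI) (auto intro: C_inf_mult dest: smooth_funD)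

lemma smooth_fun_sum:
  assumes "finite I" "openin (D_topology X) B" "\<And>i. i \<in> I \<Longrightarrow> smooth_fun X B (f i)"
  shows "smooth_fun X B (\<lambda>b. \<Sum>i\<in>I. f i b)"
  using assms(1,3) by (induction I) (auto intro: smooth_fun_const[OF assms(2)] smooth_fun_add)

lemma smooth_fun_compose:
  assumes B: "openin (D_topology X) B" and V: "openin (Euclidean_space m) V" and g: "g \<in> B \<rightarrow> V"
    "\<And>j. j < m \<Longrightarrow> smooth_fun X B (\<lambda>b. g b j)" and h: "C_inf m V h"
  shows "smooth_fun X B (\<lambda>b. h (g b))"
proof (rule smooth_funI[OF B])
  fix n U p assume U: "openin (Euclidean_space n) U" and p: "(n, U, p) \<in> plots X" "p \<in> U \<rightarrow> B"
  show "C_inf n U (\<lambda>u. h (g (p u)))"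
  proof (rule C_inf_compose[OF U V _ _ h])
    show "(\<lambda>u. g (p u)) \<in> U \<rightarrow> V" using g(1) p(2) by auto
    show "C_inf n U (\<lambda>u. g (p u) j)" if "j < m" for j
      by (rule smooth_funD(2)[OF g(2)[OF that] p])
  qed
qed

text \<open>A plot need not land in \<open>B\<close>, where \<open>g\<close> is smooth, so it is
  first cut down to the open preimage of \<open>B\<close>; there \<open>C_inf_map_preimage\<close>
  applies.\<close>

lemma openin_smooth_preimage:
  assumes B: "openin (D_topology X) B" and C: "openin (Euclidean_space m) C"
    and g: "g \<in> B \<rightarrow> topspace (Euclidean_space m)" "\<And>j. j < m \<Longrightarrow> smooth_fun X B (\<lambda>b. g b j)"
  shows "openin (D_topology X) {b \<in> B. g b \<in> C}"
proof -
  have "openin (Euclidean_space n) {u \<in> U. p u \<in> {b \<in> B. g b \<in> C}}" if p: "(n, U, p) \<in> plots X" for n U p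
  proof -
    let ?U = "{u \<in> U. p u \<in> B}"
    have U: "openin (Euclidean_space n) ?U"
      using B p by (auto simp: openin_D_topology)
    have "C_inf n ?U (\<lambda>u. g (restrict p ?U u) j)" if "j < m" for j
      by (rule smooth_funD(2)[OF g(2)[OF that] plots_restrict[OF p U]]) auto
    then have "C_inf n ?U (\<lambda>u. g (p u) j)" if "j < m" for j
      using that C_inf_cong[OF U, of "\<lambda>u. g (restrict p ?U u) j" "\<lambda>u. g (p u) j"] by simp
    then have "openin (Euclidean_space n) {u \<in> ?U. g (p u) \<in> C}"
      using g(1) by (intro C_inf_map_preimage[OF U C]) auto
    moreover have "{u \<in> ?U. g (p u) \<in> C} = {u \<in> U. p u \<in> {b \<in> B. g b \<in> C}}"
      by auto
    ultimately show ?thesis by simp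
  qed
  then show ?thesis
    using B openin_subset[OF B] by (auto simp: openin_D_topology)
qed

lemma local_maps_real_iff:
  "(B, restrict f B) \<in> local_maps X x real_dspace \<longleftrightarrow> x \<in> B \<and> smooth_fun X B f"
proof -
  have "C_inf n U (compose U (restrict f B) p) \<longleftrightarrow> C_inf n U (\<lambda>u. f (p u))"
    if "(n, U, p) \<in> plots X" "p \<in> U \<rightarrow> B" for n U p
    by (rule C_inf_cong[OF plots_openin[OF that(1)]]) (use that(2) in \<open>auto simp: compose_def\<close>)
  then show ?thesis
    using plots_openin plots_extensional
    by (fastforce simp: local_maps_def smooth_fun_def smooth_map_def subdiffeology_def real_dspace_def
        PiE_iff compose_extensional)
qed

lemma local_maps_iff:
  "(B, restrict g B) \<in> local_maps X x (euclidean_dspace m V) \<longleftrightarrow>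
    openin (D_topology X) B \<and> x \<in> B \<and> g \<in> B \<rightarrow> V \<and> (\<forall>j<m. smooth_fun X B (\<lambda>b. g b j))"
proof -
  have "C_inf n U (\<lambda>u. compose U (restrict g B) p u j) \<longleftrightarrow> C_inf n U (\<lambda>u. g (p u) j)"
    if "(n, U, p) \<in> plots X" "p \<in> U \<rightarrow> B" for n U p j
    by (rule C_inf_cong[OF plots_openin[OF that(1)]]) (use that(2) in \<open>auto simp: compose_def\<close>)
  moreover have "compose U (restrict g B) p \<in> U \<rightarrow>\<^sub>E V" if "g \<in> B \<rightarrow> V" "p \<in> U \<rightarrow> B"
    for p and U :: "(nat \<Rightarrow> real) set"
    using that by (auto simp: compose_def)
  ultimately show ?thesis
    using plots_openin plots_extensional
    by (fastforce simp: local_maps_def smooth_fun_def smooth_map_def subdiffeology_def euclidean_dspace_def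
        C_inf_map_def PiE_iff)
qed

end

section \<open>The isomorphism\<close>

definition fun_germ :: "'a dspace \<Rightarrow> 'a \<Rightarrow> 'a set \<Rightarrow> ('a \<Rightarrow> real) \<Rightarrow> ('a, real) germ" where
  "fun_germ X x B f = germ_of X x real_dspace B (restrict f B)"

definition comma_object_of ::
  "'a dspace \<Rightarrow> 'a \<Rightarrow> nat \<Rightarrow> (nat \<Rightarrow> real) set \<Rightarrow> 'a set \<Rightarrow> ('a \<Rightarrow> nat \<Rightarrow> real) \<Rightarrow> 'a comma_object" where
  "comma_object_of X x m V B g =
     ((m, V, g x), germ_of X x (euclidean_dspace m V) B (restrict g B))"

text \<open>The representative chosen by \<open>SOME\<close> agrees with \<open>h\<close> on an open
  set around \<open>u\<close>, and partials at \<open>u\<close> see only that set.\<close>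

lemma tangent_map_germ_of:
  assumes U: "openin (Euclidean_space n) U"
    and h: "(C, restrict h C) \<in> local_maps (euclidean_dspace n U) u (euclidean_dspace m V)"
  shows "tangent_map (n, U, u) (m, V, v)
      (germ_of (euclidean_dspace n U) u (euclidean_dspace m V) C (restrict h C)) = differential n m h u"
proof (rule SOME_germ_of[OF h])
  fix C' h' W
  let ?s = "germ_of (euclidean_dspace n U) u (euclidean_dspace m V) C (restrict h C)"
  assume r: "(SOME r. r \<in> ?s) = (C', h')"
    and W: "openin (D_topology (euclidean_dspace n U)) W" "u \<in> W" "W \<subseteq> C \<inter> C'"
    and eq: "\<And>b. b \<in> W \<Longrightarrow> restrict h C b = h' b"
  have W': "openin (Euclidean_space n) W"
    using W(1) openin_D_topology_euclidean[OF U] by simp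
  have "partial i (\<lambda>u. h' u j) u = partial i (\<lambda>u. h u j) u" if "i < n" for i j
  proof (rule partial_cong[OF W' W(2) that])
    fix w assume "w \<in> W"
    then show "h' w j = h w j" using eq[of w] W(3) by (auto simp: restrict_def split: if_splits)
  qed
  then show "tangent_map (n, U, u) (m, V, v) ?s = differential n m h u"
    by (simp add: r differential_def partial_def fun_eq_iff)
qed

context diffeological_space
begin

subsection \<open>Germs of functions\<close>

lemma fun_germ_cong:
  assumes "x \<in> B" "smooth_fun X B f" "x \<in> B'" "smooth_fun X B' f'"
    and "openin (D_topology X) W" "x \<in> W" "W \<subseteq> B \<inter> B'" "\<And>b. b \<in> W \<Longrightarrow> f b = f' b"
  shows "fun_germ X x B f = fun_germ X x B' f'"
  unfolding fun_germ_def
  by (rule germ_of_cong[OF _ _ assms(5-7)]) (use assms in \<open>auto simp: local_maps_real_iff\<close>)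

lemma fun_germ_in_germs:
  "x \<in> B \<Longrightarrow> smooth_fun X B f \<Longrightarrow> fun_germ X x B f \<in> function_germs X x"
  unfolding fun_germ_def by (rule germ_of_in_germs) (simp add: local_maps_real_iff)

lemma function_germsE:
  assumes "G \<in> function_germs X x"
  obtains B f where "x \<in> B" "smooth_fun X B f" "G = fun_germ X x B f"
proof -
  obtain B f where f: "(B, f) \<in> local_maps X x real_dspace" "G = germ_of X x real_dspace B f"
    using assms by (rule germsE)
  have "restrict f B = f" by (rule local_mapsD(4)[OF f(1)])
  with f show ?thesis
    using that[of B f] local_maps_real_iff[of B f x] by (simp add: fun_germ_def)
qed

lemma SOME_fun_germ:
  assumes "x \<in> B" "smooth_fun X B f"
  obtains B' f' W where "(SOME r. r \<in> fun_germ X x B f) = (B', f')" "x \<in> B'" "smooth_fun X B' f'"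
    "openin (D_topology X) W" "x \<in> W" "W \<subseteq> B \<inter> B'" "\<And>b. b \<in> W \<Longrightarrow> f b = f' b"
proof -
  have "(B, restrict f B) \<in> local_maps X x real_dspace"
    using assms by (simp add: local_maps_real_iff)
  then show ?thesis
  proof (rule SOME_germ_of)
    fix B' f' W
    assume r: "(SOME r. r \<in> germ_of X x real_dspace B (restrict f B)) = (B', f')"
      and f': "(B', f') \<in> local_maps X x real_dspace"
      and W: "openin (D_topology X) W" "x \<in> W" "W \<subseteq> B \<inter> B'"
      and eq: "\<And>b. b \<in> W \<Longrightarrow> restrict f B b = f' b"
    have "restrict f' B' = f'" by (rule local_mapsD(4)[OF f'])
    then have "x \<in> B' \<and> smooth_fun X B' f'"
      using f' local_maps_real_iff[of B' f' x] by simp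
    moreover have "f b = f' b" if "b \<in> W" for b
      using eq[OF that] W(3) that by (auto simp: restrict_def split: if_splits)
    ultimately show ?thesis
      using that[of B' f' W] r W by (simp add: fun_germ_def)
  qed
qed

lemma germ_value_fun_germ:
  "x \<in> B \<Longrightarrow> smooth_fun X B f \<Longrightarrow> germ_value x (fun_germ X x B f) = f x"
  unfolding fun_germ_def by (subst germ_value_germ_of) (auto simp: local_maps_real_iff)

text \<open>Serves both \<open>germ_add\<close> and \<open>germ_mult\<close>: changing both
  representatives changes nothing on the intersection of the two neighbourhoods of
  agreement.\<close>

lemma UN_fun_germ:
  assumes op: "\<And>B f g. smooth_fun X B f \<Longrightarrow> smooth_fun X B g \<Longrightarrow> smooth_fun X B (\<lambda>b. op (f b) (g b))"
    and f: "x \<in> B" "smooth_fun X B f" and f': "x \<in> B'" "smooth_fun X B' f'"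
  shows "(\<Union>(B, g)\<in>fun_germ X x B f. \<Union>(B', h)\<in>fun_germ X x B' f'.
      germ_of X x real_dspace (B \<inter> B') (\<lambda>b\<in>B \<inter> B'. op (g b) (h b))) =
    fun_germ X x (B \<inter> B') (\<lambda>b. op (f b) (f' b))"
proof -
  have L: "(B, restrict f B) \<in> local_maps X x real_dspace" "(B', restrict f' B') \<in> local_maps X x real_dspace"
    using f f' by (simp_all add: local_maps_real_iff)
  have loc: "(B \<inter> B', \<lambda>b\<in>B \<inter> B'. op (g b) (h b)) \<in> local_maps X x real_dspace"
    if "(B, restrict g B) \<in> local_maps X x real_dspace" "(B', restrict h B') \<in> local_maps X x real_dspace"
    for B B' g h
  proof -
    have gh: "x \<in> B" "smooth_fun X B g" "x \<in> B'" "smooth_fun X B' h"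
      using that by (simp_all add: local_maps_real_iff)
    have o: "openin (D_topology X) (B \<inter> B')"
      using gh smooth_funD(1) by (intro openin_Int) auto
    have "smooth_fun X (B \<inter> B') (\<lambda>b. op (g b) (h b))"
      by (intro op smooth_fun_mono[OF gh(2) o] smooth_fun_mono[OF gh(4) o]) auto
    then show ?thesis
      using gh by (simp add: local_maps_real_iff)
  qed
  show ?thesis
    unfolding fun_germ_def
  proof (rule UN_germ_of[OF L(1)], rule UN_germ_of[OF L(2)])
    fix B1 g1 W1 B2 g2 W2
    assume 1: "(B1, g1) \<in> local_maps X x real_dspace" "openin (D_topology X) W1" "x \<in> W1"
        "W1 \<subseteq> B \<inter> B1" "\<And>b. b \<in> W1 \<Longrightarrow> restrict f B b = g1 b"
      and 2: "(B2, g2) \<in> local_maps X x real_dspace" "openin (D_topology X) W2" "x \<in> W2"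
        "W2 \<subseteq> B' \<inter> B2" "\<And>b. b \<in> W2 \<Longrightarrow> restrict f' B' b = g2 b"
    have "restrict g1 B1 = g1" "restrict g2 B2 = g2"
      using local_mapsD(4)[OF 1(1)] local_mapsD(4)[OF 2(1)] .
    then have l: "(B1 \<inter> B2, \<lambda>b\<in>B1 \<inter> B2. op (g1 b) (g2 b)) \<in> local_maps X x real_dspace"
      using loc[of B1 g1 B2 g2] 1(1) 2(1) by simp
    show "germ_of X x real_dspace (B1 \<inter> B2) (\<lambda>b\<in>B1 \<inter> B2. op (g1 b) (g2 b)) =
          germ_of X x real_dspace (B \<inter> B') (\<lambda>b\<in>B \<inter> B'. op (f b) (f' b))"
    proof (rule germ_of_cong[OF l loc[OF L] openin_Int[OF 1(2) 2(2)]])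
      fix b assume b: "b \<in> W1 \<inter> W2"
      then have "b \<in> B" "b \<in> B1" "b \<in> B'" "b \<in> B2" using 1(4) 2(4) by auto
      with b 1(5)[of b] 2(5)[of b]
      show "(\<lambda>b\<in>B1 \<inter> B2. op (g1 b) (g2 b)) b = (\<lambda>b\<in>B \<inter> B'. op (f b) (f' b)) b"
        by simp
    qed (use 1(3,4) 2(3,4) in auto)
  qed
qed

lemma germ_add_fun_germ:
  assumes "x \<in> B" "smooth_fun X B f" "x \<in> B'" "smooth_fun X B' f'"
  shows "germ_add X x (fun_germ X x B f) (fun_germ X x B' f') = fun_germ X x (B \<inter> B') (\<lambda>b. f b + f' b)"
  unfolding germ_add_def by (rule UN_fun_germ[OF smooth_fun_add assms])

lemma germ_mult_fun_germ:
  assumes "x \<in> B" "smooth_fun X B f" "x \<in> B'" "smooth_fun X B' f'"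
  shows "germ_mult X x (fun_germ X x B f) (fun_germ X x B' f') = fun_germ X x (B \<inter> B') (\<lambda>b. f b * f' b)"
  unfolding germ_mult_def by (rule UN_fun_germ[OF smooth_fun_mult assms])

lemma smooth_fun_scale: "smooth_fun X B f \<Longrightarrow> smooth_fun X B (\<lambda>b. c * f b)"
  by (rule smooth_fun_mult[OF smooth_fun_const[OF smooth_funD(1)]])

lemma germ_scale_fun_germ:
  assumes "x \<in> B" "smooth_fun X B f"
  shows "germ_scale X x c (fun_germ X x B f) = fun_germ X x B (\<lambda>b. c * f b)"
  unfolding germ_scale_def fun_germ_def
proof (rule UN_germ_of)
  show L: "(B, restrict f B) \<in> local_maps X x real_dspace"
    using assms by (simp add: local_maps_real_iff)
  have loc: "(B, \<lambda>b\<in>B. c * g b) \<in> local_maps X x real_dspace"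
    if "(B, restrict g B) \<in> local_maps X x real_dspace" for B g
    using that smooth_fun_scale[of B g c] by (simp add: local_maps_real_iff)
  fix B1 g1 W1
  assume 1: "(B1, g1) \<in> local_maps X x real_dspace" "openin (D_topology X) W1" "x \<in> W1"
    "W1 \<subseteq> B \<inter> B1" "\<And>b. b \<in> W1 \<Longrightarrow> restrict f B b = g1 b"
  have "restrict g1 B1 = g1" using local_mapsD(4)[OF 1(1)] .
  then have l: "(B1, \<lambda>b\<in>B1. c * g1 b) \<in> local_maps X x real_dspace"
    using loc[of B1 g1] 1(1) by simp
  show "germ_of X x real_dspace B1 (\<lambda>b\<in>B1. c * g1 b) = germ_of X x real_dspace B (\<lambda>b\<in>B. c * f b)"
  proof (rule germ_of_cong[OF l loc[OF L] 1(2,3)])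
    fix b assume b: "b \<in> W1"
    then have "b \<in> B" "b \<in> B1" using 1(4) by auto
    with b 1(5)[of b] show "(\<lambda>b\<in>B1. c * g1 b) b = (\<lambda>b\<in>B. c * f b) b"
      by simp
  qed (use 1(4) in auto)
qed

subsection \<open>Derivations\<close>

lemma derivationD:
  assumes D: "D \<in> right_tangent_space X x" and x: "x \<in> B"
    and f: "smooth_fun X B f" and g: "smooth_fun X B g"
  shows "D (fun_germ X x B (\<lambda>b. f b + g b)) = D (fun_germ X x B f) + D (fun_germ X x B g)"
    and "D (fun_germ X x B (\<lambda>b. c * f b)) = c * D (fun_germ X x B f)"
    and "D (fun_germ X x B (\<lambda>b. f b * g b)) = f x * D (fun_germ X x B g) + g x * D (fun_germ X x B f)"
proof -
  note G = fun_germ_in_germs[OF x f] fun_germ_in_germs[OF x g]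
  have add: "D (germ_add X x (fun_germ X x B f) (fun_germ X x B g)) =
      D (fun_germ X x B f) + D (fun_germ X x B g)"
    and scale: "D (germ_scale X x c (fun_germ X x B f)) = c * D (fun_germ X x B f)"
    and mult: "D (germ_mult X x (fun_germ X x B f) (fun_germ X x B g)) =
      germ_value x (fun_germ X x B f) * D (fun_germ X x B g) +
      germ_value x (fun_germ X x B g) * D (fun_germ X x B f)"
    using D G unfolding right_tangent_space_def by simp_all
  show "D (fun_germ X x B (\<lambda>b. f b + g b)) = D (fun_germ X x B f) + D (fun_germ X x B g)"
    using add by (simp add: germ_add_fun_germ[OF x f x g])
  show "D (fun_germ X x B (\<lambda>b. c * f b)) = c * D (fun_germ X x B f)"
    using scale by (simp add: germ_scale_fun_germ[OF x f])
  show "D (fun_germ X x B (\<lambda>b. f b * g b)) =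
      f x * D (fun_germ X x B g) + g x * D (fun_germ X x B f)"
    using mult by (simp add: germ_mult_fun_germ[OF x f x g] germ_value_fun_germ[OF x f] germ_value_fun_germ[OF x g])
qed

text \<open>The Leibniz rule for 1 * 1 gives D(1) = 2 D(1), hence D(1) = 0; scaling gives the other
  constants.\<close>

lemma derivation_const:
  assumes D: "D \<in> right_tangent_space X x" and x: "x \<in> B" and B: "openin (D_topology X) B"
  shows "D (fun_germ X x B (\<lambda>b. c)) = 0"
proof -
  have one: "smooth_fun X B (\<lambda>b. 1)" by (rule smooth_fun_const[OF B])
  have "D (fun_germ X x B (\<lambda>b. 1)) = 0"
    using derivationD(3)[OF D x one one] by simp
  then show ?thesis
    using derivationD(2)[OF D x one one, of c] by simp
qed

lemma derivation_sum:
  assumes D: "D \<in> right_tangent_space X x" and x: "x \<in> B" and B: "openin (D_topology X) B"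
    and "finite I" "\<And>i. i \<in> I \<Longrightarrow> smooth_fun X B (f i)"
  shows "D (fun_germ X x B (\<lambda>b. \<Sum>i\<in>I. f i b)) = (\<Sum>i\<in>I. D (fun_germ X x B (f i)))"
  using assms(4,5)
proof (induction I)
  case empty
  then show ?case using derivation_const[OF D x B, of 0] by simp
next
  case (insert i I)
  have "smooth_fun X B (\<lambda>b. \<Sum>i\<in>I. f i b)"
    using insert.prems by (intro smooth_fun_sum[OF insert.hyps(1) B]) auto
  from derivationD(1)[OF D x insert.prems[of i] this] insert show ?case
    by simp
qed

text \<open>The composite has its own domain \<open>B'\<close> inside \<open>B\<close>, because
  composing germs shrinks \<open>B\<close> to the part that \<open>g\<close> sends into the domain
  of \<open>h\<close>.\<close>

lemma derivation_compose:
  assumes D: "D \<in> right_tangent_space X x" and x: "x \<in> B" and B: "openin (D_topology X) B"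
    and C: "openin (Euclidean_space m) C" "g x \<in> C" and h: "C_inf m C h"
    and g: "g \<in> B \<rightarrow> topspace (Euclidean_space m)" "\<And>j. j < m \<Longrightarrow> smooth_fun X B (\<lambda>b. g b j)"
    and hg: "x \<in> B'" "smooth_fun X B' f" "B' \<subseteq> B" "\<And>b. b \<in> B' \<Longrightarrow> f b = h (g b)"
  shows "D (fun_germ X x B' f) = (\<Sum>j<m. partial j h (g x) * D (fun_germ X x B (\<lambda>b. g b j)))"
proof -
  let ?v = "g x"
  obtain e where e: "0 < e" "cube m ?v e \<subseteq> C"
    using openin_contains_cube[OF C] .
  have v: "?v \<in> topspace (Euclidean_space m)"
    using C openin_subset by blast
  have "C_inf m (cube m ?v e) h"
    by (rule C_inf_mono[OF C(1) openin_cube e(2) h])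
  then obtain q where q: "\<forall>i<m. C_inf m (cube m ?v e) (q i)"
      "\<forall>i<m. q i ?v = partial i h ?v"
      "\<forall>u\<in>cube m ?v e. h u = h ?v + (\<Sum>i<m. (u i - ?v i) * q i u)"
    by (rule Hadamard[OF v e(1)])
  \<comment> \<open>Hadamard's expansion holds only on the cube, so all germs are computed on its
    preimage.\<close>
  let ?A = "{b \<in> B'. g b \<in> cube m ?v e}"
  have B': "openin (D_topology X) B'" by (rule smooth_funD(1)[OF hg(2)])
  have A: "openin (D_topology X) ?A"
    by (rule openin_smooth_preimage[OF B' openin_cube])
       (use g hg(3) smooth_fun_mono[OF g(2) B'] in auto)
  have xA: "x \<in> ?A"
    using hg(1) center_in_cube[OF v e(1)] by simp
  have gA: "smooth_fun X ?A (\<lambda>b. g b i)" if "i < m" for i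
    by (rule smooth_fun_mono[OF g(2)[OF that] A]) (use hg(3) in auto)
  have dA: "smooth_fun X ?A (\<lambda>b. g b i - ?v i)" if "i < m" for i
    using smooth_fun_add[OF gA[OF that] smooth_fun_const[OF A, of "- ?v i"]] by simp
  have qA: "smooth_fun X ?A (\<lambda>b. q i (g b))" if "i < m" for i
    by (rule smooth_fun_compose[OF A openin_cube _ gA q(1)[rule_format, OF that]]) auto
  \<comment> \<open>The factor \<open>g b i - ?v i\<close> vanishes at \<open>x\<close>, so only the
    Leibniz term with \<open>q i\<close> evaluated at \<open>?v\<close> survives, and the constant
    \<open>?v i\<close> contributes 0.\<close>
  have term_i: "D (fun_germ X x ?A (\<lambda>b. (g b i - ?v i) * q i (g b))) =
      partial i h ?v * D (fun_germ X x B (\<lambda>b. g b i))" if i: "i < m" for i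
  proof -
    have "D (fun_germ X x ?A (\<lambda>b. g b i - ?v i)) = D (fun_germ X x ?A (\<lambda>b. g b i))"
      using derivationD(1)[OF D xA gA[OF i] smooth_fun_const[OF A, of "- ?v i"]]
        derivation_const[OF D xA A, of "- ?v i"] by simp
    also have "fun_germ X x ?A (\<lambda>b. g b i) = fun_germ X x B (\<lambda>b. g b i)"
      by (rule fun_germ_cong[OF xA gA[OF i] x g(2)[OF i] A xA]) (use hg(3) in auto)
    finally show ?thesis
      using derivationD(3)[OF D xA dA[OF i] qA[OF i]] q(2) i by simp
  qed
  have sA: "smooth_fun X ?A (\<lambda>b. (g b i - ?v i) * q i (g b))" if "i < m" for i
    by (rule smooth_fun_mult[OF dA[OF that] qA[OF that]])
  have SA: "smooth_fun X ?A (\<lambda>b. \<Sum>i<m. (g b i - ?v i) * q i (g b))"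
    by (rule smooth_fun_sum[OF finite_lessThan A]) (use sA in auto)
  have "fun_germ X x B' f = fun_germ X x ?A (\<lambda>b. h ?v + (\<Sum>i<m. (g b i - ?v i) * q i (g b)))"
    by (rule fun_germ_cong[OF hg(1,2) xA smooth_fun_add[OF smooth_fun_const[OF A] SA] A xA])
       (use hg(4) q(3) in auto)
  then show ?thesis
    using derivationD(1)[OF D xA smooth_fun_const[OF A] SA, of "h ?v"] derivation_const[OF D xA A]
      derivation_sum[OF D xA A finite_lessThan, of m "\<lambda>i b. (g b i - ?v i) * q i (g b)"] sA term_i
    by simp
qed

end

section \<open>The real line as a target, and the two inverse constructions\<close>

lemma pointed_germs_germ_of:
  "(B, f) \<in> local_maps X x Y \<Longrightarrow> germ_of X x Y B f \<in> pointed_germs X x Y (f x)"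
  by (simp add: pointed_germs_def germ_of_in_germs germ_value_germ_of)

lemma pointed_germsE:
  assumes "G \<in> pointed_germs X x Y y"
  obtains B f where "(B, restrict f B) \<in> local_maps X x Y" "G = germ_of X x Y B (restrict f B)" "f x = y"
proof -
  have "G \<in> germs X x Y" "germ_value x G = y"
    using assms by (auto simp: pointed_germs_def)
  from this(1) obtain B f where f: "(B, f) \<in> local_maps X x Y" "G = germ_of X x Y B f"
    by (rule germsE)
  then show ?thesis
    using that[of B f] germ_value_germ_of[OF f(1)] local_mapsD(4)[OF f(1)] \<open>germ_value x G = y\<close> by simp
qed

text \<open>A copy of R among the Euclidean open sets: function germs take values in
  \<open>real_dspace\<close>, whereas objects of the comma category need an open subset of some
  R^m.\<close>

definition line :: "(nat \<Rightarrow> real) set" where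
  "line = topspace (Euclidean_space 1)"

definition line_coord :: "real \<Rightarrow> nat \<Rightarrow> real" where
  "line_coord r = (\<lambda>i. if i = 0 then r else 0)"

lemma openin_line: "openin (Euclidean_space 1) line"
  by (simp add: line_def)

lemma line_coord_in_line: "line_coord r \<in> line"
  by (simp add: line_def line_coord_def topspace_Euclidean_space)

definition line_object :: "'a dspace \<Rightarrow> 'a \<Rightarrow> 'a set \<Rightarrow> ('a \<Rightarrow> real) \<Rightarrow> 'a comma_object" where
  "line_object X x B f = comma_object_of X x 1 line B (\<lambda>b. line_coord (f b))"

text \<open>Index 0 is the only coordinate of a tangent vector of the line. The value 0 off
  \<open>function_germs\<close> is the normalization in \<open>right_tangent_space\<close>.\<close>

definition derivation_of :: "'a dspace \<Rightarrow> 'a \<Rightarrow> ('a comma_object \<Rightarrow> nat \<Rightarrow> real) \<Rightarrow> ('a, real) germ \<Rightarrow> real" where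
  "derivation_of X x w G =
     (if G \<in> function_germs X x then (case SOME r. r \<in> G of (B, f) \<Rightarrow> w (line_object X x B f) 0) else 0)"

text \<open>The inner default 0 puts the vector into R^m, the outer one makes the family vanish off
  the index set; \<open>Ran_tangent\<close> demands both.\<close>

definition family_of :: "'a dspace \<Rightarrow> 'a \<Rightarrow> (('a, real) germ \<Rightarrow> real) \<Rightarrow> 'a comma_object \<Rightarrow> nat \<Rightarrow> real" where
  "family_of X x D K =
     (if K \<in> comma_objects X x then
        case K of ((m, V, v), G) \<Rightarrow> case SOME r. r \<in> G of (B, g) \<Rightarrow>
          (\<lambda>j. if j < m then D (fun_germ X x B (\<lambda>b. g b j)) else 0)
      else 0)"

lemma differential_linear:
  "differential n m f u (a + b) = differential n m f u a + differential n m f u b"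
  "differential n m f u (c *\<^sub>R a) = c *\<^sub>R differential n m f u a"
  "differential n m f u 0 = 0"
  by (auto simp: differential_def fun_eq_iff scaleR_fun_def distrib_left sum.distrib
      sum_distrib_left mult.left_commute)

lemma tangent_map_linear:
  "tangent_map E F s (a + b) = tangent_map E F s a + tangent_map E F s b"
  "tangent_map E F s (c *\<^sub>R a) = c *\<^sub>R tangent_map E F s a"
  "tangent_map E F s 0 = 0"
  by (cases E; cases F; simp add: differential_linear)+

lemma tangent_space_closed:
  "a \<in> tangent_space E \<Longrightarrow> b \<in> tangent_space E \<Longrightarrow> a + b \<in> tangent_space E"
  "a \<in> tangent_space E \<Longrightarrow> c *\<^sub>R a \<in> tangent_space E"
  "0 \<in> tangent_space E"
  by (cases E; simp add: topspace_Euclidean_space scaleR_fun_def)+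

lemma subspace_Ran_tangent: "subspace (Ran_tangent X x)"
proof (rule subspaceI)
  show "0 \<in> Ran_tangent X x"
    by (simp add: Ran_tangent_def tangent_map_linear(3) tangent_space_closed(3))
  show "u + v \<in> Ran_tangent X x" if "u \<in> Ran_tangent X x" "v \<in> Ran_tangent X x" for u v
    using that by (simp add: Ran_tangent_def tangent_map_linear(1) tangent_space_closed(1))
  show "c *\<^sub>R u \<in> Ran_tangent X x" if "u \<in> Ran_tangent X x" for c u
    using that by (simp add: Ran_tangent_def scaleR_fun_def[of c u] tangent_map_linear(2) tangent_space_closed(2))
qed

lemma subspace_right_tangent_space: "subspace (right_tangent_space X x)"
  by (rule subspaceI) (simp_all add: right_tangent_space_def scaleR_fun_def algebra_simps)

text \<open>The representative chosen in \<open>derivation_of\<close> depends on the germ and not on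
  the family, so both sides evaluate at the same object.\<close>

lemma derivation_of_linear:
  "derivation_of X x (u + v) = derivation_of X x u + derivation_of X x v"
  "derivation_of X x (c *\<^sub>R u) = c *\<^sub>R derivation_of X x u"
  by (simp_all add: derivation_of_def fun_eq_iff scaleR_fun_def split: prod.splits)

context diffeological_space
begin

lemma local_maps_compose:
  assumes V: "openin (Euclidean_space m) V"
    and g: "(B, restrict g B) \<in> local_maps X x (euclidean_dspace m V)"
    and h: "(C, restrict h C) \<in> local_maps (euclidean_dspace m V) (g x) (euclidean_dspace m' V')"
  shows "({b \<in> B. g b \<in> C}, \<lambda>b\<in>{b \<in> B. g b \<in> C}. h (g b)) \<in> local_maps X x (euclidean_dspace m' V')"
proof -
  have G: "openin (D_topology X) B" "x \<in> B" "g \<in> B \<rightarrow> V" "\<And>j. j < m \<Longrightarrow> smooth_fun X B (\<lambda>b. g b j)"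
    using g by (simp_all add: local_maps_iff)
  have H: "openin (Euclidean_space m) C" "g x \<in> C" "h \<in> C \<rightarrow> V'" "\<And>j. j < m' \<Longrightarrow> C_inf m C (\<lambda>u. h u j)"
    using h by (simp_all add: local_maps_euclidean_iff[OF V])
  have A: "openin (D_topology X) {b \<in> B. g b \<in> C}"
    by (rule openin_smooth_preimage[OF G(1) H(1) _ G(4)]) (use G(3) openin_subset[OF V] in auto)
  have "smooth_fun X {b \<in> B. g b \<in> C} (\<lambda>b. h (g b) j)" if "j < m'" for j
    by (rule smooth_fun_compose[OF A H(1) _ smooth_fun_mono[OF G(4) A] H(4)[OF that]]) auto
  then show ?thesis
    using A G(2) H(2,3) by (auto simp: local_maps_iff)
qed

lemma germ_compose_germ_of:
  assumes V: "openin (Euclidean_space m) V"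
    and g: "(B, restrict g B) \<in> local_maps X x (euclidean_dspace m V)"
    and h: "(C, restrict h C) \<in> local_maps (euclidean_dspace m V) (g x) (euclidean_dspace m' V')"
  shows "germ_compose X x (euclidean_dspace m' V')
      (germ_of (euclidean_dspace m V) (g x) (euclidean_dspace m' V') C (restrict h C))
      (germ_of X x (euclidean_dspace m V) B (restrict g B)) =
    germ_of X x (euclidean_dspace m' V') {b \<in> B. g b \<in> C} (\<lambda>b\<in>{b \<in> B. g b \<in> C}. h (g b))"
  unfolding germ_compose_def
proof (rule UN_germ_of[OF h], rule UN_germ_of[OF g])
  fix C1 h1 W1 B1 g1 W2
  assume 1: "(C1, h1) \<in> local_maps (euclidean_dspace m V) (g x) (euclidean_dspace m' V')"
      "openin (D_topology (euclidean_dspace m V)) W1" "g x \<in> W1"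
      "W1 \<subseteq> C \<inter> C1" "\<And>b. b \<in> W1 \<Longrightarrow> restrict h C b = h1 b"
    and 2: "(B1, g1) \<in> local_maps X x (euclidean_dspace m V)" "openin (D_topology X) W2" "x \<in> W2"
      "W2 \<subseteq> B \<inter> B1" "\<And>b. b \<in> W2 \<Longrightarrow> restrict g B b = g1 b"
  have geq: "g1 b = g b" if "b \<in> W2" for b
    using 2(5)[OF that] that 2(4) by (auto simp: restrict_def split: if_splits)
  have heq: "h1 u = h u" if "u \<in> W1" for u
    using 1(5)[OF that] that 1(4) by (auto simp: restrict_def split: if_splits)
  have g1: "(B1, restrict g1 B1) \<in> local_maps X x (euclidean_dspace m V)"
    using 2(1) local_mapsD(4)[OF 2(1)] by simp
  have h1: "(C1, restrict h1 C1) \<in> local_maps (euclidean_dspace m V) (g1 x) (euclidean_dspace m' V')"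
    using 1(1) local_mapsD(4)[OF 1(1)] geq[OF 2(3)] by simp
  have W1: "openin (Euclidean_space m) W1"
    using 1(2) openin_D_topology_euclidean[OF V] by simp
  have G: "g \<in> B \<rightarrow> V" "\<And>j. j < m \<Longrightarrow> smooth_fun X B (\<lambda>b. g b j)"
    using g by (simp_all add: local_maps_iff)
  \<comment> \<open>The composites of old and new representatives agree where \<open>b\<close> lies
    in \<open>W2\<close> and \<open>g b\<close> in \<open>W1\<close>.\<close>
  have W: "openin (D_topology X) {b \<in> W2. g b \<in> W1}"
    by (rule openin_smooth_preimage[OF 2(2) W1 _ smooth_fun_mono[OF G(2) 2(2)]])
       (use G(1) 2(4) openin_subset[OF V] in auto)
  show "germ_of X x (euclidean_dspace m' V') {b \<in> B1. g1 b \<in> C1} (\<lambda>b\<in>{b \<in> B1. g1 b \<in> C1}. h1 (g1 b)) =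
      germ_of X x (euclidean_dspace m' V') {b \<in> B. g b \<in> C} (\<lambda>b\<in>{b \<in> B. g b \<in> C}. h (g b))"
  proof (rule germ_of_cong[OF local_maps_compose[OF V g1 h1] local_maps_compose[OF V g h] W])
    show "x \<in> {b \<in> W2. g b \<in> W1}" using 2(3) 1(3) by simp
    show "{b \<in> W2. g b \<in> W1} \<subseteq> {b \<in> B1. g1 b \<in> C1} \<inter> {b \<in> B. g b \<in> C}"
      using 2(4) 1(4) geq by auto
    fix b assume "b \<in> {b \<in> W2. g b \<in> W1}"
    then have "b \<in> B" "b \<in> B1" "g b \<in> C" "g b \<in> C1" "g1 b = g b" "h1 (g b) = h (g b)"
      using 2(4) 1(4) geq heq by auto
    then show "(\<lambda>b\<in>{b \<in> B1. g1 b \<in> C1}. h1 (g1 b)) b = (\<lambda>b\<in>{b \<in> B. g b \<in> C}. h (g b)) b"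
      by simp
  qed
qed

subsection \<open>The comma category\<close>

lemma comma_object_of_cong:
  assumes "(B, restrict g B) \<in> local_maps X x (euclidean_dspace m V)"
    and "(B', restrict g' B') \<in> local_maps X x (euclidean_dspace m V)"
    and "openin (D_topology X) W" "x \<in> W" "W \<subseteq> B \<inter> B'" "\<And>b. b \<in> W \<Longrightarrow> g b = g' b"
  shows "comma_object_of X x m V B g = comma_object_of X x m V B' g'"
proof -
  have "germ_of X x (euclidean_dspace m V) B (restrict g B) =
      germ_of X x (euclidean_dspace m V) B' (restrict g' B')"
    by (rule germ_of_cong[OF assms(1-5)]) (use assms(5,6) in auto)
  then show ?thesis
    using assms(4,6) by (simp add: comma_object_of_def)
qed

lemma comma_object_of_in:
  assumes "openin (Euclidean_space m) V" "(B, restrict g B) \<in> local_maps X x (euclidean_dspace m V)"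
  shows "comma_object_of X x m V B g \<in> comma_objects X x"
proof -
  have "x \<in> B" "g \<in> B \<rightarrow> V" using assms by (simp_all add: local_maps_iff)
  then show ?thesis
    using pointed_germs_germ_of[OF assms(2)] assms(1)
    by (auto simp: comma_object_of_def comma_objects_def eucl_objects_def)
qed

lemma comma_objectsE:
  assumes "K \<in> comma_objects X x"
  obtains m V B g where "openin (Euclidean_space m) V"
    "(B, restrict g B) \<in> local_maps X x (euclidean_dspace m V)" "K = comma_object_of X x m V B g"
proof -
  obtain m V v G where K: "K = ((m, V, v), G)" by (metis prod.exhaust)
  with assms have V: "openin (Euclidean_space m) V" and G: "G \<in> pointed_germs X x (euclidean_dspace m V) v"
    by (auto simp: comma_objects_def eucl_objects_def)
  from G show ?thesis
    by (rule pointed_germsE) (use that[OF V] K in \<open>simp add: comma_object_of_def\<close>)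
qed

text \<open>The germ of \<open>h\<close> is a morphism from the object of \<open>g\<close> to that
  of the composite, so compatibility of \<open>w\<close> becomes an equation between
  representatives.\<close>

lemma Ran_tangent_natural:
  assumes w: "w \<in> Ran_tangent X x" and V: "openin (Euclidean_space m) V" "openin (Euclidean_space m') V'"
    and g: "(B, restrict g B) \<in> local_maps X x (euclidean_dspace m V)"
    and h: "(C, restrict h C) \<in> local_maps (euclidean_dspace m V) (g x) (euclidean_dspace m' V')"
  shows "w (comma_object_of X x m' V' {b \<in> B. g b \<in> C} (\<lambda>b. h (g b))) =
    differential m m' h (g x) (w (comma_object_of X x m V B g))"
proof -
  let ?s = "germ_of (euclidean_dspace m V) (g x) (euclidean_dspace m' V') C (restrict h C)"
  let ?K = "comma_object_of X x m V B g"
  let ?L = "comma_object_of X x m' V' {b \<in> B. g b \<in> C} (\<lambda>b. h (g b))"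
  have "g x \<in> C" using local_mapsD(2)[OF h] .
  then have "?s \<in> comma_morphisms X x ?K ?L"
    using pointed_germs_germ_of[OF h] germ_compose_germ_of[OF V(1) g h]
    by (simp add: comma_object_of_def)
  moreover have "?K \<in> comma_objects X x" "?L \<in> comma_objects X x"
    by (rule comma_object_of_in[OF V(1) g] comma_object_of_in[OF V(2) local_maps_compose[OF V(1) g h]])+
  ultimately have "tangent_map (fst ?K) (fst ?L) ?s (w ?K) = w ?L"
    using w unfolding Ran_tangent_def by blast
  then show ?thesis
    using tangent_map_germ_of[OF V(1) h] by (simp add: comma_object_of_def)
qed

text \<open>Every object and morphism has representatives, and the target of a morphism is
  determined by its source and the morphism, so composites are the only targets to check.\<close>

lemma Ran_tangentI:
  assumes "\<And>K. K \<notin> comma_objects X x \<Longrightarrow> w K = 0"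
    and "\<And>m V B g. openin (Euclidean_space m) V \<Longrightarrow>
      (B, restrict g B) \<in> local_maps X x (euclidean_dspace m V) \<Longrightarrow>
      w (comma_object_of X x m V B g) \<in> topspace (Euclidean_space m)"
    and "\<And>m V m' V' B g C h. openin (Euclidean_space m) V \<Longrightarrow> openin (Euclidean_space m') V' \<Longrightarrow>
      (B, restrict g B) \<in> local_maps X x (euclidean_dspace m V) \<Longrightarrow>
      (C, restrict h C) \<in> local_maps (euclidean_dspace m V) (g x) (euclidean_dspace m' V') \<Longrightarrow>
      differential m m' h (g x) (w (comma_object_of X x m V B g)) =
      w (comma_object_of X x m' V' {b \<in> B. g b \<in> C} (\<lambda>b. h (g b)))"
  shows "w \<in> Ran_tangent X x"
proof -
  have "w K \<in> tangent_space (fst K)" if K: "K \<in> comma_objects X x" for K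
    using K by (rule comma_objectsE) (use assms(2) in \<open>simp add: comma_object_of_def\<close>)
  moreover have "tangent_map (fst K) (fst L) s (w K) = w L"
    if K: "K \<in> comma_objects X x" and L: "L \<in> comma_objects X x" and s: "s \<in> comma_morphisms X x K L"
    for K L s
  proof -
    obtain m V B g where V: "openin (Euclidean_space m) V"
      and g: "(B, restrict g B) \<in> local_maps X x (euclidean_dspace m V)"
      and K': "K = comma_object_of X x m V B g"
      using K by (rule comma_objectsE)
    obtain m' V' v' H where L': "L = ((m', V', v'), H)" by (metis prod.exhaust)
    then have V': "openin (Euclidean_space m') V'"
      using L by (auto simp: comma_objects_def eucl_objects_def)
    have s1: "s \<in> pointed_germs (euclidean_dspace m V) (g x) (euclidean_dspace m' V') v'"
      and s2: "germ_compose X x (euclidean_dspace m' V') s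
        (germ_of X x (euclidean_dspace m V) B (restrict g B)) = H"
      using s by (simp_all add: K' L' comma_object_of_def)
    obtain C h where h: "(C, restrict h C) \<in> local_maps (euclidean_dspace m V) (g x) (euclidean_dspace m' V')"
      "s = germ_of (euclidean_dspace m V) (g x) (euclidean_dspace m' V') C (restrict h C)" "h (g x) = v'"
      using s1 by (rule pointed_germsE)
    have "L = comma_object_of X x m' V' {b \<in> B. g b \<in> C} (\<lambda>b. h (g b))"
      using s2 germ_compose_germ_of[OF V g h(1)] by (simp add: L' h(2,3) comma_object_of_def)
    moreover have "tangent_map (fst K) (fst L) s = differential m m' h (g x)"
      using tangent_map_germ_of[OF V h(1)] by (simp add: K' L' h(2) comma_object_of_def)
    ultimately show ?thesis
      using assms(3)[OF V V' g h(1)] by (simp add: K')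
  qed
  ultimately show ?thesis
    using assms(1) unfolding Ran_tangent_def by blast
qed

subsection \<open>From compatible families to derivations\<close>

lemma local_maps_line:
  assumes "x \<in> B" "smooth_fun X B f"
  shows "(B, \<lambda>b\<in>B. line_coord (f b)) \<in> local_maps X x (euclidean_dspace 1 line)"
  using assms smooth_funD(1)[OF assms(2)] line_coord_in_line
  by (auto simp: local_maps_iff line_coord_def)

lemma derivation_of_fun_germ:
  assumes f: "x \<in> B" "smooth_fun X B f"
  shows "derivation_of X x w (fun_germ X x B f) = w (line_object X x B f) 0"
proof (rule SOME_fun_germ[OF f])
  fix B' f' W
  assume r: "(SOME r. r \<in> fun_germ X x B f) = (B', f')" and f': "x \<in> B'" "smooth_fun X B' f'"
    and W: "openin (D_topology X) W" "x \<in> W" "W \<subseteq> B \<inter> B'" "\<And>b. b \<in> W \<Longrightarrow> f b = f' b"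
  have "line_object X x B f = line_object X x B' f'"
    unfolding line_object_def
    by (rule comma_object_of_cong[OF local_maps_line[OF f] local_maps_line[OF f'] W(1-3)]) (simp add: W(4))
  then show "derivation_of X x w (fun_germ X x B f) = w (line_object X x B f) 0"
    using fun_germ_in_germs[OF f] by (simp add: derivation_of_def r)
qed

text \<open>Following \<open>h\<close> by \<open>line_coord\<close> gives a morphism from the object
  of \<open>g\<close> to the line. Its Jacobian has the partials of \<open>h\<close> as its only
  row.\<close>

lemma derivation_of_compose:
  assumes w: "w \<in> Ran_tangent X x" and V: "openin (Euclidean_space m) V"
    and g: "(B, restrict g B) \<in> local_maps X x (euclidean_dspace m V)" and h: "C_inf m V h"
  shows "derivation_of X x w (fun_germ X x B (\<lambda>b. h (g b))) =
    (\<Sum>j<m. partial j h (g x) * w (comma_object_of X x m V B g) j)"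
proof -
  have G: "openin (D_topology X) B" "x \<in> B" "g \<in> B \<rightarrow> V" "\<And>j. j < m \<Longrightarrow> smooth_fun X B (\<lambda>b. g b j)"
    using g by (simp_all add: local_maps_iff)
  have hg: "smooth_fun X B (\<lambda>b. h (g b))"
    by (rule smooth_fun_compose[OF G(1) V G(3,4) h])
  have "C_inf m V (\<lambda>u. line_coord (h u) 0)"
    using h by (simp add: line_coord_def)
  then have "(V, \<lambda>u\<in>V. line_coord (h u)) \<in> local_maps (euclidean_dspace m V) (g x) (euclidean_dspace 1 line)"
    using V G(2,3) line_coord_in_line by (auto simp: local_maps_euclidean_iff)
  from Ran_tangent_natural[OF w V openin_line g this]
  have "w (comma_object_of X x 1 line {b \<in> B. g b \<in> V} (\<lambda>b. line_coord (h (g b)))) =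
      differential m 1 (\<lambda>u. line_coord (h u)) (g x) (w (comma_object_of X x m V B g))" .
  moreover have "{b \<in> B. g b \<in> V} = B" using G(3) by auto
  ultimately show ?thesis
    by (simp add: derivation_of_fun_germ[OF G(2) hg] line_object_def differential_def partial_def line_coord_def)
qed

text \<open>A coordinate function in \<open>derivation_of_compose\<close> leaves a single term,
  which recovers the entries of \<open>w\<close> at \<open>g\<close> from its entries at functions.
  Substituting back eliminates the former from the general formula.\<close>

lemma derivation_of_chain:
  assumes w: "w \<in> Ran_tangent X x" and V: "openin (Euclidean_space m) V"
    and g: "(B, restrict g B) \<in> local_maps X x (euclidean_dspace m V)" and h: "C_inf m V h"
  shows "derivation_of X x w (fun_germ X x B (\<lambda>b. h (g b))) =
    (\<Sum>j<m. partial j h (g x) * derivation_of X x w (fun_germ X x B (\<lambda>b. g b j)))"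
    and "i < m \<Longrightarrow> derivation_of X x w (fun_germ X x B (\<lambda>b. g b i)) = w (comma_object_of X x m V B g) i"
proof -
  have "partial j (\<lambda>u. u i) u = (if j = i then 1 else 0)" for i j u
    by (auto simp: partial_def)
  then show coord: "derivation_of X x w (fun_germ X x B (\<lambda>b. g b i)) = w (comma_object_of X x m V B g) i"
    if "i < m" for i
    using derivation_of_compose[OF w V g C_inf_coordinate[OF V], of i] that
    by (simp add: if_distrib[of "\<lambda>a. a * _"] cong: if_cong)
  show "derivation_of X x w (fun_germ X x B (\<lambda>b. h (g b))) =
    (\<Sum>j<m. partial j h (g x) * derivation_of X x w (fun_germ X x B (\<lambda>b. g b j)))"
    using derivation_of_compose[OF w V g h] coord by simp
qed

text \<open>The chain rule for the pairing of \<open>f\<close> and \<open>f'\<close> as a germ into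
  R^2, where \<open>a\<close> and \<open>a'\<close> are the two partials of \<open>op\<close>. Sum,
  product and scaling are instances.\<close>

lemma derivation_of_binary:
  assumes w: "w \<in> Ran_tangent X x" and x: "x \<in> B" and f: "smooth_fun X B f" "smooth_fun X B f'"
    and op: "C_inf 2 (topspace (Euclidean_space 2)) (\<lambda>u. op (u 0) (u 1))"
    and a: "((\<lambda>t. op t (f' x)) has_real_derivative a) (at (f x))"
    and a': "((\<lambda>t. op (f x) t) has_real_derivative a') (at (f' x))"
  shows "derivation_of X x w (fun_germ X x B (\<lambda>b. op (f b) (f' b))) =
    a * derivation_of X x w (fun_germ X x B f) + a' * derivation_of X x w (fun_germ X x B f')"
proof -
  let ?V = "topspace (Euclidean_space 2)"
  define g where "g b = (\<lambda>i::nat. if i = 0 then f b else if i = 1 then f' b else 0)" for b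
  have g0: "g b 0 = f b" and g1: "g b (Suc 0) = f' b" for b by (simp_all add: g_def)
  have "smooth_fun X B (\<lambda>b. g b j)" if "j < 2" for j
    using f that by (auto simp: less_2_cases_iff g0 g1)
  moreover have "g b \<in> ?V" for b
    by (simp add: g_def topspace_Euclidean_space)
  ultimately have g: "(B, restrict g B) \<in> local_maps X x (euclidean_dspace 2 ?V)"
    using x smooth_funD(1)[OF f(1)] by (simp add: local_maps_iff)
  have "partial 0 (\<lambda>u. op (u 0) (u 1)) (g x) = a" "partial 1 (\<lambda>u. op (u 0) (u 1)) (g x) = a'"
    using DERIV_imp_deriv[OF a] DERIV_imp_deriv[OF a'] by (simp_all add: partial_def g0 g1)
  with derivation_of_chain(1)[OF w _ g op] show ?thesis
    by (simp add: g0 g1 numeral_2_eq_2)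
qed

lemma derivation_of_in_right_tangent_space:
  assumes w: "w \<in> Ran_tangent X x"
  shows "derivation_of X x w \<in> right_tangent_space X x"
proof -
  let ?D = "derivation_of X x w"
  have C: "C_inf 2 (topspace (Euclidean_space 2)) (\<lambda>u. u 0 + u 1)"
    "C_inf 2 (topspace (Euclidean_space 2)) (\<lambda>u. u 0 * u 1)"
    "C_inf 2 (topspace (Euclidean_space 2)) (\<lambda>u. c * u 0)" for c
    by (intro C_inf_add C_inf_mult C_inf_coordinate C_inf_const openin_topspace)+
  have bin: "?D (germ_add X x G H) = ?D G + ?D H \<and>
      ?D (germ_mult X x G H) = germ_value x G * ?D H + germ_value x H * ?D G"
    if G: "G \<in> function_germs X x" and H: "H \<in> function_germs X x" for G H
  proof -
    obtain B f where f: "x \<in> B" "smooth_fun X B f" "G = fun_germ X x B f"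
      using G by (rule function_germsE)
    obtain B' f' where f': "x \<in> B'" "smooth_fun X B' f'" "H = fun_germ X x B' f'"
      using H by (rule function_germsE)
    let ?B = "B \<inter> B'"
    have o: "openin (D_topology X) ?B"
      by (rule openin_Int[OF smooth_funD(1)[OF f(2)] smooth_funD(1)[OF f'(2)]])
    have x: "x \<in> ?B" using f(1) f'(1) by simp
    have s: "smooth_fun X ?B f" "smooth_fun X ?B f'"
      using smooth_fun_mono[OF f(2) o] smooth_fun_mono[OF f'(2) o] by auto
    \<comment> \<open>Pairing requires a common neighbourhood, so both germs are first restricted to
      \<open>?B\<close>.\<close>
    have "fun_germ X x B f = fun_germ X x ?B f" "fun_germ X x B' f' = fun_germ X x ?B f'"
      by (rule fun_germ_cong[OF f(1,2) x s(1) o x] fun_germ_cong[OF f'(1,2) x s(2) o x]; auto)+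
    moreover have "?D (fun_germ X x ?B (\<lambda>b. f b + f' b)) =
        1 * ?D (fun_germ X x ?B f) + 1 * ?D (fun_germ X x ?B f')"
      by (rule derivation_of_binary[OF w x s C(1)]) (auto intro!: derivative_eq_intros)
    moreover have "?D (fun_germ X x ?B (\<lambda>b. f b * f' b)) =
        f' x * ?D (fun_germ X x ?B f) + f x * ?D (fun_germ X x ?B f')"
      by (rule derivation_of_binary[OF w x s C(2)]) (auto intro!: derivative_eq_intros)
    ultimately show ?thesis
      using germ_add_fun_germ[OF f(1,2) f'(1,2)] germ_mult_fun_germ[OF f(1,2) f'(1,2)]
        germ_value_fun_germ[OF f(1,2)] germ_value_fun_germ[OF f'(1,2)]
      by (simp add: f(3) f'(3))
  qed
  have scale: "?D (germ_scale X x c G) = c * ?D G" if G: "G \<in> function_germs X x" for c G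
  proof -
    obtain B f where f: "x \<in> B" "smooth_fun X B f" "G = fun_germ X x B f"
      using G by (rule function_germsE)
    \<comment> \<open>Scaling is treated as a binary operation constant in its second argument,
      which is filled with \<open>f\<close> again and gets coefficient 0.\<close>
    have "?D (fun_germ X x B (\<lambda>b. c * f b)) = c * ?D (fun_germ X x B f) + 0 * ?D (fun_germ X x B f)"
      by (rule derivation_of_binary[OF w f(1,2,2) C(3)[of c]]) (auto intro!: derivative_eq_intros)
    then show ?thesis
      by (simp add: f(3) germ_scale_fun_germ[OF f(1,2)])
  qed
  have "?D G = 0" if "G \<notin> function_germs X x" for G
    using that by (simp add: derivation_of_def)
  then show ?thesis
    using bin scale unfolding right_tangent_space_def by blast
qed

subsection \<open>From derivations to compatible families\<close>

lemma family_of_comma_object_of: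
  assumes V: "openin (Euclidean_space m) V"
    and g: "(B, restrict g B) \<in> local_maps X x (euclidean_dspace m V)"
  shows "family_of X x D (comma_object_of X x m V B g) =
    (\<lambda>j. if j < m then D (fun_germ X x B (\<lambda>b. g b j)) else 0)"
proof (rule SOME_germ_of[OF g])
  fix B' g' W
  let ?G = "germ_of X x (euclidean_dspace m V) B (restrict g B)"
  assume r: "(SOME r. r \<in> ?G) = (B', g')" and g': "(B', g') \<in> local_maps X x (euclidean_dspace m V)"
    and W: "openin (D_topology X) W" "x \<in> W" "W \<subseteq> B \<inter> B'"
    and eq: "\<And>b. b \<in> W \<Longrightarrow> restrict g B b = g' b"
  have G: "x \<in> B" "\<And>j. j < m \<Longrightarrow> smooth_fun X B (\<lambda>b. g b j)"
    using g by (simp_all add: local_maps_iff)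
  have "(B', restrict g' B') \<in> local_maps X x (euclidean_dspace m V)"
    using g' local_mapsD(4)[OF g'] by simp
  then have G': "x \<in> B'" "\<And>j. j < m \<Longrightarrow> smooth_fun X B' (\<lambda>b. g' b j)"
    by (simp_all add: local_maps_iff)
  have geq: "g' b = g b" if "b \<in> W" for b
    using eq[OF that] that W(3) by (auto simp: restrict_def split: if_splits)
  have "fun_germ X x B' (\<lambda>b. g' b j) = fun_germ X x B (\<lambda>b. g b j)" if "j < m" for j
    by (rule fun_germ_cong[OF G'(1) G'(2)[OF that] G(1) G(2)[OF that] W(1,2)]) (use W(3) geq in auto)
  then show "family_of X x D (comma_object_of X x m V B g) =
      (\<lambda>j. if j < m then D (fun_germ X x B (\<lambda>b. g b j)) else 0)"
    using comma_object_of_in[OF V g] by (auto simp: family_of_def comma_object_of_def r)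
qed

text \<open>Coordinate \<open>j\<close> of the compatibility equation is
  \<open>derivation_compose\<close> applied to the coordinate \<open>j\<close> of
  \<open>h\<close>.\<close>

lemma family_of_in_Ran_tangent:
  assumes D: "D \<in> right_tangent_space X x"
  shows "family_of X x D \<in> Ran_tangent X x"
proof (rule Ran_tangentI)
  show "family_of X x D K = 0" if "K \<notin> comma_objects X x" for K
    using that by (simp add: family_of_def)
next
  fix m V B g
  assume "openin (Euclidean_space m) V" "(B, restrict g B) \<in> local_maps X x (euclidean_dspace m V)"
  then show "family_of X x D (comma_object_of X x m V B g) \<in> topspace (Euclidean_space m)"
    by (simp add: family_of_comma_object_of topspace_Euclidean_space)
next
  fix m V m' V' B g C h
  assume V: "openin (Euclidean_space m) V" and V': "openin (Euclidean_space m') V'"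
    and g: "(B, restrict g B) \<in> local_maps X x (euclidean_dspace m V)"
    and h: "(C, restrict h C) \<in> local_maps (euclidean_dspace m V) (g x) (euclidean_dspace m' V')"
  let ?A = "{b \<in> B. g b \<in> C}"
  note hg = local_maps_compose[OF V g h]
  have G: "openin (D_topology X) B" "x \<in> B" "g \<in> B \<rightarrow> topspace (Euclidean_space m)"
    "\<And>j. j < m \<Longrightarrow> smooth_fun X B (\<lambda>b. g b j)"
    using g openin_subset[OF V] by (auto simp: local_maps_iff)
  have C: "openin (Euclidean_space m) C" "g x \<in> C" "\<And>j. j < m' \<Longrightarrow> C_inf m C (\<lambda>u. h u j)"
    using h by (simp_all add: local_maps_euclidean_iff[OF V])
  have "D (fun_germ X x ?A (\<lambda>b. h (g b) j)) =
      (\<Sum>i<m. partial i (\<lambda>u. h u j) (g x) * D (fun_germ X x B (\<lambda>b. g b i)))" if j: "j < m'" for j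
  proof (rule derivation_compose[OF D G(2,1) C(1,2) C(3)[OF j] G(3,4)])
    show "smooth_fun X ?A (\<lambda>b. h (g b) j)"
      using hg j by (simp add: local_maps_iff)
  qed (use G(2) C(2) in auto)
  then show "differential m m' h (g x) (family_of X x D (comma_object_of X x m V B g)) =
      family_of X x D (comma_object_of X x m' V' ?A (\<lambda>b. h (g b)))"
    by (auto simp: family_of_comma_object_of[OF V g] family_of_comma_object_of[OF V' hg]
        differential_def partial_def fun_eq_iff)
qed

lemma family_of_derivation_of:
  assumes w: "w \<in> Ran_tangent X x"
  shows "family_of X x (derivation_of X x w) = w"
proof
  fix K
  show "family_of X x (derivation_of X x w) K = w K"
  proof (cases "K \<in> comma_objects X x")
    case False
    moreover from this w have "w K = 0" unfolding Ran_tangent_def by blast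
    ultimately show ?thesis by (simp add: family_of_def)
  next
    case True
    then obtain m V B g where V: "openin (Euclidean_space m) V"
      and g: "(B, restrict g B) \<in> local_maps X x (euclidean_dspace m V)"
      and K: "K = comma_object_of X x m V B g"
      by (rule comma_objectsE)
    have "w K \<in> tangent_space (fst K)"
      using w True by (simp add: Ran_tangent_def)
    \<comment> \<open>A tangent vector of R^m has no entries from \<open>m\<close> on, in agreement
      with the default in \<open>family_of\<close>.\<close>
    then have "w K j = 0" if "\<not> j < m" for j
      using that by (simp add: K comma_object_of_def topspace_Euclidean_space)
    then show ?thesis
      using derivation_of_chain(2)[OF w V g C_inf_const[OF V]]
      by (auto simp: K family_of_comma_object_of[OF V g])
  qed
qed

text \<open>Coordinate 0 of the line object of \<open>f\<close> is \<open>f\<close> itself, so the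
  round trip returns \<open>D\<close> at its germ.\<close>

lemma derivation_of_family_of:
  assumes D: "D \<in> right_tangent_space X x"
  shows "derivation_of X x (family_of X x D) = D"
proof
  fix G
  show "derivation_of X x (family_of X x D) G = D G"
  proof (cases "G \<in> function_germs X x")
    case False
    then show ?thesis using D by (simp add: derivation_of_def right_tangent_space_def)
  next
    case True
    then obtain B f where f: "x \<in> B" "smooth_fun X B f" "G = fun_germ X x B f"
      by (rule function_germsE)
    then show ?thesis
      using family_of_comma_object_of[OF openin_line local_maps_line[OF f(1,2)], of D]
      by (simp add: derivation_of_fun_germ line_object_def line_coord_def)
  qed
qed

lemma linear_iso_derivation_of:
  "linear_iso (Ran_tangent X x) (right_tangent_space X x) (derivation_of X x)"
proof -
  have "bij_betw (derivation_of X x) (Ran_tangent X x) (right_tangent_space X x)"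
    by (rule bij_betw_byWitness[where f' = "family_of X x"])
       (auto intro: family_of_derivation_of derivation_of_family_of
         derivation_of_in_right_tangent_space family_of_in_Ran_tangent)
  then show ?thesis
    by (simp add: linear_iso_def subspace_Ran_tangent subspace_right_tangent_space derivation_of_linear)
qed

end

theorem theorem4p4:
  fixes X :: "'a dspace" and x :: 'a
  assumes "diffeological_space X" and "x \<in> points X"
  shows "\<exists>\<phi>. linear_iso (Ran_tangent X x) (right_tangent_space X x) \<phi>"
  using diffeological_space.linear_iso_derivation_of[OF assms(1)] by blast

end
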